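(* Let $\dot q=f_0(q)+u_1f_1(q)+u_2f_2(q)$, $u_1,u_2\in\mathbb R$, be a control-affine system on a $5$-dimensional manifold $M$. The set ${\rm Abn}(q)$ is an affine line, provided that $\dim(D_2^2+D_3)=4$ and $\dim D_3^2=5$.
   Context: All objects are $C^\infty$; $f_0,f_1,f_2$ are linearly independent. $V(q)=\{f_0(q)+u_1f_1(q)+u_2f_2(q):u_1,u_2\in\mathbb R\}$, $D_2={\rm span}(f_1,f_2)$, $D_3={\rm span}(f_0,f_1,f_2)$, and $D^2=D+[D,D]$ for a distribution $D$. On $T^*M$ put $h_i(p,q)=p\cdot f_i(q)$, $i=0,1,2$, with Poisson brackets $\{h_i,h_j\}(p,q)=p\cdot[f_i,f_j](q)$; $\vec h$ is the Hamiltonian vector field of $h$ and $\pi:T^*M\to M$ the projection (so $\pi_*\vec h_i=f_i$); $D^\perp\subset T^*M$ denotes the annihilator of $D$. On $(D_2)^\perp\setminus(D_2^2)^\perp$ let $$\vec X=\vec h_0+\frac{\{h_0,h_2\}}{\{h_2,h_1\}}\vec h_1+\frac{\{h_1,h_0\}}{\{h_2,h_1\}}\vec h_2,$$ and $${\rm Abn}(q)=\{\pi_*\vec X(\lambda):\lambda\in T_q^*M\cap(D_3)^\perp\setminus(D_2^2)^\perp\}\subset V(q)$$ (the velocities at $q$ of abnormal extremal trajectories of the time optimal problem having a lift in $(D_2)^\perp\setminus(D_2^2)^\perp$). *)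

theory Defs
  imports "HOL-Analysis.Analysis" "HOL-Library.Function_Algebras"
begin

instantiation "fun" :: (type, real_vector) real_vector
begin

definition scaleR_fun :: "real \<Rightarrow> ('a \<Rightarrow> 'b) \<Rightarrow> 'a \<Rightarrow> 'b"
  where "scaleR_fun r f = (\<lambda>x. r *\<^sub>R f x)"

instance
  by standard (simp_all add: scaleR_fun_def fun_eq_iff algebra_simps)

end

lemma scaleR_fun_apply [simp]: "(r *\<^sub>R f) x = r *\<^sub>R f x"
  by (simp add: scaleR_fun_def)

section \<open>Smooth manifolds\<close>

primrec C_on :: "nat \<Rightarrow> 'a::real_normed_vector set \<Rightarrow> ('a \<Rightarrow> 'b::real_normed_vector) \<Rightarrow> bool"
  where
    "C_on 0 S f \<longleftrightarrow> continuous_on S f"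
  | "C_on (Suc k) S f \<longleftrightarrow> (\<forall>x\<in>S. f differentiable (at x)) \<and>
       (\<forall>v. C_on k S (\<lambda>x. frechet_derivative f (at x) v))"

text \<open>Meaningful for open \<open>S\<close> only, the one case in which it is used.\<close>

definition smooth_on :: "'a::real_normed_vector set \<Rightarrow> ('a \<Rightarrow> 'b::real_normed_vector) \<Rightarrow> bool"
  where "smooth_on S f \<longleftrightarrow> (\<forall>k. C_on k S f)"

text \<open>A chart is its domain together with its coordinate map.\<close>

type_synonym ('m, 'e) chart = "'m set \<times> ('m \<Rightarrow> 'e)"

definition chart_inv :: "('m, 'e) chart \<Rightarrow> 'e \<Rightarrow> 'm"
  where "chart_inv c = inv_into (fst c) (snd c)"

definition transition :: "('m, 'e) chart \<Rightarrow> ('m, 'e) chart \<Rightarrow> 'e \<Rightarrow> 'e"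
  where "transition c d = snd d \<circ> chart_inv c"

definition smooth_manifold :: "'m topology \<Rightarrow> ('m, 'e::euclidean_space) chart set \<Rightarrow> bool"
  where "smooth_manifold M A \<longleftrightarrow>
    Hausdorff_space M \<and> second_countable M \<and> topspace M = \<Union> (fst ` A) \<and>
    (\<forall>(U, \<phi>)\<in>A. openin M U \<and> open (\<phi> ` U) \<and>
       homeomorphic_map (subtopology M U) (top_of_set (\<phi> ` U)) \<phi>) \<and>
    (\<forall>c\<in>A. \<forall>d\<in>A. smooth_on (snd c ` (fst c \<inter> fst d)) (transition c d))"

section \<open>Tangent vectors and vector fields\<close>

text \<open>
  A tangent vector at \<open>q\<close> is the family of its coordinate representatives, indexed by the charts
  around \<open>q\<close>, which transform by the Jacobians of the transition maps. The value \<open>0\<close> at all other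
  indices makes the representation unique.
\<close>

type_synonym ('m, 'e) tvec = "('m, 'e) chart \<Rightarrow> 'e"

definition tangent_space ::
  "('m, 'e::euclidean_space) chart set \<Rightarrow> 'm \<Rightarrow> ('m, 'e) tvec set"
  where "tangent_space A q = {v.
    (\<forall>c. \<not> (c \<in> A \<and> q \<in> fst c) \<longrightarrow> v c = 0) \<and>
    (\<forall>c\<in>A. \<forall>d\<in>A. q \<in> fst c \<inter> fst d \<longrightarrow>
       v d = frechet_derivative (transition c d) (at (snd c q)) (v c))}"

text \<open>The tangent vector at \<open>q\<close> whose representative in the chart \<open>c\<close> is \<open>w\<close>.\<close>

definition coord_vector ::
  "('m, 'e::euclidean_space) chart set \<Rightarrow> ('m, 'e) chart \<Rightarrow> 'm \<Rightarrow> 'e \<Rightarrow> ('m, 'e) tvec"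
  where "coord_vector A c q w = (\<lambda>d. if d \<in> A \<and> q \<in> fst d
    then frechet_derivative (transition c d) (at (snd c q)) w else 0)"

type_synonym ('m, 'e) vfield = "'m \<Rightarrow> ('m, 'e) tvec"

definition local_rep :: "('m, 'e) chart \<Rightarrow> ('m, 'e) vfield \<Rightarrow> 'e \<Rightarrow> 'e"
  where "local_rep c f x = f (chart_inv c x) c"

definition smooth_vfield :: "('m, 'e::euclidean_space) chart set \<Rightarrow> ('m, 'e) vfield \<Rightarrow> bool"
  where "smooth_vfield A f \<longleftrightarrow>
    (\<forall>q\<in>\<Union> (fst ` A). f q \<in> tangent_space A q) \<and>
    (\<forall>c\<in>A. smooth_on (snd c ` fst c) (local_rep c f))"

definition lie_bracket ::
  "('m, 'e::euclidean_space) chart set \<Rightarrow> ('m, 'e) vfield \<Rightarrow> ('m, 'e) vfield \<Rightarrow> ('m, 'e) vfield"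
  where "lie_bracket A f g q = (\<lambda>c. if c \<in> A \<and> q \<in> fst c
    then frechet_derivative (local_rep c g) (at (snd c q)) (f q c)
       - frechet_derivative (local_rep c f) (at (snd c q)) (g q c)
    else 0)"

section \<open>Distributions\<close>

type_synonym ('m, 'e) distr = "'m \<Rightarrow> ('m, 'e) tvec set"

definition span_distr :: "('m, 'e::euclidean_space) vfield set \<Rightarrow> ('m, 'e) distr"
  where "span_distr F q = span ((\<lambda>f. f q) ` F)"

definition distr_sum ::
  "('m, 'e::euclidean_space) distr \<Rightarrow> ('m, 'e) distr \<Rightarrow> ('m, 'e) distr"
  where "distr_sum D E q = {v + w | v w. v \<in> D q \<and> w \<in> E q}"

definition sections ::
  "('m, 'e::euclidean_space) chart set \<Rightarrow> ('m, 'e) distr \<Rightarrow> ('m, 'e) vfield set"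
  where "sections A D = {f. smooth_vfield A f \<and> (\<forall>q\<in>\<Union> (fst ` A). f q \<in> D q)}"

definition bracket_distr ::
  "('m, 'e::euclidean_space) chart set \<Rightarrow> ('m, 'e) distr \<Rightarrow> ('m, 'e) distr"
  where "bracket_distr A D q =
    span {lie_bracket A f g q | f g. f \<in> sections A D \<and> g \<in> sections A D}"

definition square_distr ::
  "('m, 'e::euclidean_space) chart set \<Rightarrow> ('m, 'e) distr \<Rightarrow> ('m, 'e) distr"
  where "square_distr A D = distr_sum D (bracket_distr A D)"

section \<open>The cotangent bundle\<close>

definition cotangent_space ::
  "('m, 'e::euclidean_space) chart set \<Rightarrow> 'm \<Rightarrow> (('m, 'e) tvec \<Rightarrow> real) set"
  where "cotangent_space A q = {p.
    (\<forall>v\<in>tangent_space A q. \<forall>w\<in>tangent_space A q. p (v + w) = p v + p w) \<and>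
    (\<forall>r. \<forall>v\<in>tangent_space A q. p (r *\<^sub>R v) = r * p v) \<and>
    (\<forall>v. v \<notin> tangent_space A q \<longrightarrow> p v = 0)}"

text \<open>Points of \<open>T\<^sup>*M\<close> are written \<open>(q, p)\<close> with the base point first.\<close>

type_synonym ('m, 'e) ctvec = "'m \<times> (('m, 'e) tvec \<Rightarrow> real)"

definition cotangent_fibre ::
  "('m, 'e::euclidean_space) chart set \<Rightarrow> 'm \<Rightarrow> ('m, 'e) ctvec set"
  where "cotangent_fibre A q = {q} \<times> cotangent_space A q"

definition annihilator ::
  "('m, 'e::euclidean_space) chart set \<Rightarrow> ('m, 'e) distr \<Rightarrow> ('m, 'e) ctvec set"
  where "annihilator A D =
    {(q, p). q \<in> \<Union> (fst ` A) \<and> p \<in> cotangent_space A q \<and> (\<forall>v\<in>D q. p v = 0)}"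

text \<open>
  A chart \<open>c\<close> of \<open>M\<close> induces canonical coordinates \<open>(x, \<xi>)\<close> on \<open>T\<^sup>*M\<close>: the covector with
  coordinates \<open>\<xi>\<close> acts on a tangent vector \<open>v\<close> as \<open>\<xi> \<bullet> v c\<close>.
\<close>

definition ct_coords ::
  "('m, 'e::euclidean_space) chart set \<Rightarrow> ('m, 'e) chart \<Rightarrow> ('m, 'e) ctvec \<Rightarrow> 'e \<times> 'e"
  where "ct_coords A c = (\<lambda>(q, p).
    (snd c q, \<Sum>b\<in>Basis. p (coord_vector A c q b) *\<^sub>R b))"

definition ct_coords_inv ::
  "('m, 'e::euclidean_space) chart set \<Rightarrow> ('m, 'e) chart \<Rightarrow> 'e \<times> 'e \<Rightarrow> ('m, 'e) ctvec"
  where "ct_coords_inv A c = (\<lambda>(x, \<xi>).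
    (chart_inv c x, \<lambda>v. if v \<in> tangent_space A (chart_inv c x) then \<xi> \<bullet> v c else 0))"

text \<open>
  Derivative of a function \<open>H\<close> on \<open>T\<^sup>*M\<close> at the point \<open>\<eta>\<close>, in the canonical coordinates
  induced by \<open>c\<close>.
\<close>

definition ct_derivative ::
  "('m, 'e::euclidean_space) chart set \<Rightarrow> ('m, 'e) chart \<Rightarrow> (('m, 'e) ctvec \<Rightarrow> real) \<Rightarrow>
    ('m, 'e) ctvec \<Rightarrow> 'e \<times> 'e \<Rightarrow> real"
  where "ct_derivative A c H \<eta> = frechet_derivative (H \<circ> ct_coords_inv A c) (at (ct_coords A c \<eta>))"

text \<open>
  Tangent vectors of \<open>T\<^sup>*M\<close> are again families of coordinate representatives, now for the
  charts of \<open>T\<^sup>*M\<close> induced by the charts of \<open>M\<close>. The Hamiltonian vector field is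
  \<open>\<Sum>\<^sub>b (\<partial>H/\<partial>\<xi>\<^sub>b) \<partial>/\<partial>x\<^sub>b - (\<partial>H/\<partial>x\<^sub>b) \<partial>/\<partial>\<xi>\<^sub>b\<close>.
\<close>

type_synonym ('m, 'e) ct_tvec = "('m, 'e) chart \<Rightarrow> 'e \<times> 'e"

definition ham_field ::
  "('m, 'e::euclidean_space) chart set \<Rightarrow> (('m, 'e) ctvec \<Rightarrow> real) \<Rightarrow>
    ('m, 'e) ctvec \<Rightarrow> ('m, 'e) ct_tvec"
  where "ham_field A H \<eta> = (\<lambda>c. if c \<in> A \<and> fst \<eta> \<in> fst c
    then (\<Sum>b\<in>Basis. ct_derivative A c H \<eta> (0, b) *\<^sub>R b,
          - (\<Sum>b\<in>Basis. ct_derivative A c H \<eta> (b, 0) *\<^sub>R b))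
    else 0)"

text \<open>
  In the charts induced by \<open>c\<close> and in \<open>c\<close>, the bundle projection \<open>T\<^sup>*M \<rightarrow> M\<close> is the map
  \<open>(x, \<xi>) \<mapsto> x\<close>; this is its differential.
\<close>

definition proj_push :: "('m, 'e::euclidean_space) ct_tvec \<Rightarrow> ('m, 'e) tvec"
  where "proj_push W = (\<lambda>c. fst (W c))"

text \<open>
  The Poisson bracket \<open>{G, H}\<close> is the derivative of \<open>H\<close> along the Hamiltonian vector field of \<open>G\<close>,
  that is, \<open>\<Sum>\<^sub>b (\<partial>G/\<partial>\<xi>\<^sub>b) (\<partial>H/\<partial>x\<^sub>b) - (\<partial>G/\<partial>x\<^sub>b) (\<partial>H/\<partial>\<xi>\<^sub>b)\<close>.
  It does not depend on the chart; the sign is the one for which the bracket of the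
  Hamiltonians \<open>p \<cdot> f\<close> and \<open>p \<cdot> g\<close> is \<open>p \<cdot> [f, g]\<close>.
\<close>

definition poisson ::
  "('m, 'e::euclidean_space) chart set \<Rightarrow> (('m, 'e) ctvec \<Rightarrow> real) \<Rightarrow> (('m, 'e) ctvec \<Rightarrow> real) \<Rightarrow>
    ('m, 'e) ctvec \<Rightarrow> real"
  where "poisson A G H \<eta> = (let c = (SOME c. c \<in> A \<and> fst \<eta> \<in> fst c)
    in ct_derivative A c H \<eta> (ham_field A G \<eta> c))"

definition lift_ham :: "('m, 'e::euclidean_space) vfield \<Rightarrow> ('m, 'e) ctvec \<Rightarrow> real"
  where "lift_ham f = (\<lambda>(q, p). p (f q))"

section \<open>Abnormal velocities\<close>

definition abn_field ::
  "('m, 'e::euclidean_space) chart set \<Rightarrow> ('m, 'e) vfield \<Rightarrow> ('m, 'e) vfield \<Rightarrow> ('m, 'e) vfield \<Rightarrow>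
    ('m, 'e) ctvec \<Rightarrow> ('m, 'e) ct_tvec"
  where "abn_field A f0 f1 f2 \<eta> =
    (let h0 = lift_ham f0; h1 = lift_ham f1; h2 = lift_ham f2 in
       ham_field A h0 \<eta>
       + (poisson A h0 h2 \<eta> / poisson A h2 h1 \<eta>) *\<^sub>R ham_field A h1 \<eta>
       + (poisson A h1 h0 \<eta> / poisson A h2 h1 \<eta>) *\<^sub>R ham_field A h2 \<eta>)"

definition Abn ::
  "('m, 'e::euclidean_space) chart set \<Rightarrow> ('m, 'e) vfield \<Rightarrow> ('m, 'e) vfield \<Rightarrow> ('m, 'e) vfield \<Rightarrow>
    'm \<Rightarrow> ('m, 'e) tvec set"
  where "Abn A f0 f1 f2 q =
    {proj_push (abn_field A f0 f1 f2 \<eta>) | \<eta>.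
       \<eta> \<in> cotangent_fibre A q \<inter> annihilator A (span_distr {f0, f1, f2})
          - annihilator A (square_distr A (span_distr {f1, f2}))}"

definition affine_line :: "'v::real_vector set \<Rightarrow> bool"
  where "affine_line S \<longleftrightarrow> (\<exists>a b. a \<noteq> b \<and> S = affine hull {a, b})"

end

theory Submission
  imports Defs
begin

text \<open>
  For a covector \<open>p\<close> at \<open>q\<close> that annihilates \<open>D\<^sub>3\<close> the Poisson brackets are \<open>p \<cdot> [f\<^sub>i, f\<^sub>j]\<close>, so the
  velocity is \<open>f\<^sub>0 + (p b\<^sub>0\<^sub>2 / p b\<^sub>2\<^sub>1) f\<^sub>1 + (p b\<^sub>1\<^sub>0 / p b\<^sub>2\<^sub>1) f\<^sub>2\<close> with \<open>b\<^sub>i\<^sub>j = [f\<^sub>i, f\<^sub>j](q)\<close>. The dimension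
  hypotheses say that \<open>f\<^sub>0, f\<^sub>1, f\<^sub>2, b\<^sub>1\<^sub>2\<close> are independent at \<open>q\<close> and that, modulo their span, \<open>b\<^sub>0\<^sub>1\<close>
  and \<open>b\<^sub>0\<^sub>2\<close> are multiples \<open>\<mu> b\<close>, \<open>\<nu> b\<close> of one vector, not both zero. Hence the velocity depends
  affinely on the ratio \<open>s = p b / p b\<^sub>1\<^sub>2\<close>, with direction \<open>- \<nu> f\<^sub>1 + \<mu> f\<^sub>2 \<noteq> 0\<close>, and every real \<open>s\<close> occurs.
\<close>

section \<open>Second derivatives and brackets in Euclidean space\<close>

text \<open>The mean value theorem is applied twice: along \<open>u\<close> to
  \<open>\<psi>\<close>, the increment of \<open>g\<close> in direction \<open>v\<close>, and then
  along \<open>v\<close> to the directional derivative \<open>g' _ u\<close>. The left-hand side is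
  symmetric in \<open>u\<close> and \<open>v\<close>, which is what the comparison of mixed
  derivatives exploits.\<close>

lemma second_difference_mvt:
  fixes g :: "'a::real_normed_vector \<Rightarrow> real"
  assumes h: "0 < h"
    and S: "\<And>s t. 0 \<le> s \<Longrightarrow> s \<le> h \<Longrightarrow> 0 \<le> t \<Longrightarrow> t \<le> h \<Longrightarrow> x + s *\<^sub>R u + t *\<^sub>R v \<in> S"
    and g': "\<And>y. y \<in> S \<Longrightarrow> (g has_derivative g' y) (at y)"
    and gu: "\<And>y. y \<in> S \<Longrightarrow> ((\<lambda>y. g' y u) has_derivative gu y) (at y)"
  shows "\<exists>s t. 0 \<le> s \<and> s \<le> h \<and> 0 \<le> t \<and> t \<le> h \<and>
    g (x + h *\<^sub>R u + h *\<^sub>R v) - g (x + h *\<^sub>R u) - g (x + h *\<^sub>R v) + g x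
      = h * h * gu (x + s *\<^sub>R u + t *\<^sub>R v) v"
proof -
  define \<psi> where "\<psi> s = g (x + s *\<^sub>R u + h *\<^sub>R v) - g (x + s *\<^sub>R u)" for s
  have lin: "g' y (r *\<^sub>R u) = r * g' y u" if "y \<in> S" for y r
    using linear_scale[OF has_derivative_linear[OF g'[OF that]]] by simp
  have lin2: "gu y (r *\<^sub>R v) = r * gu y v" if "y \<in> S" for y r
    using linear_scale[OF has_derivative_linear[OF gu[OF that]]] by simp
  have "\<exists>s\<in>{0<..<h}. \<psi> h - \<psi> 0 =
      (\<lambda>r. r * (g' (x + s *\<^sub>R u + h *\<^sub>R v) u - g' (x + s *\<^sub>R u) u)) (h - 0)"
  proof (rule mvt_simple[OF h])
    fix s assume s: "0 \<le> s" "s \<le> h"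
    have 1: "x + s *\<^sub>R u + h *\<^sub>R v \<in> S" and 2: "x + s *\<^sub>R u \<in> S"
      using S[of s h] S[of s 0] s h by auto
    have "((\<lambda>s. g (x + s *\<^sub>R u + h *\<^sub>R v)) has_derivative
        (\<lambda>r. g' (x + s *\<^sub>R u + h *\<^sub>R v) (r *\<^sub>R u))) (at s within {0..h})"
      by (rule has_derivative_compose[where f = "\<lambda>s. x + s *\<^sub>R u + h *\<^sub>R v", OF _ g'[OF 1]])
        (auto intro!: derivative_eq_intros)
    moreover have "((\<lambda>s. g (x + s *\<^sub>R u)) has_derivative
        (\<lambda>r. g' (x + s *\<^sub>R u) (r *\<^sub>R u))) (at s within {0..h})"
      by (rule has_derivative_compose[where f = "\<lambda>s. x + s *\<^sub>R u", OF _ g'[OF 2]])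
        (auto intro!: derivative_eq_intros)
    ultimately show "(\<psi> has_derivative
        (\<lambda>r. r * (g' (x + s *\<^sub>R u + h *\<^sub>R v) u - g' (x + s *\<^sub>R u) u))) (at s within {0..h})"
      unfolding \<psi>_def using has_derivative_diff lin[OF 1] lin[OF 2]
      by (fastforce simp: right_diff_distrib)
  qed
  then obtain s where s: "0 < s" "s < h"
    and s_eq: "\<psi> h - \<psi> 0 = h * (g' (x + s *\<^sub>R u + h *\<^sub>R v) u - g' (x + s *\<^sub>R u) u)"
    by auto
  have "\<exists>t\<in>{0<..<h}. g' (x + s *\<^sub>R u + h *\<^sub>R v) u - g' (x + s *\<^sub>R u + 0 *\<^sub>R v) u =
      (\<lambda>r. r * gu (x + s *\<^sub>R u + t *\<^sub>R v) v) (h - 0)"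
  proof (rule mvt_simple[OF h])
    fix t assume t: "0 \<le> t" "t \<le> h"
    have 1: "x + s *\<^sub>R u + t *\<^sub>R v \<in> S"
      using S[of s t] s t by auto
    have "((\<lambda>t. g' (x + s *\<^sub>R u + t *\<^sub>R v) u) has_derivative
        (\<lambda>r. gu (x + s *\<^sub>R u + t *\<^sub>R v) (r *\<^sub>R v))) (at t within {0..h})"
      by (rule has_derivative_compose[where f = "\<lambda>t. x + s *\<^sub>R u + t *\<^sub>R v", OF _ gu[OF 1]])
        (auto intro!: derivative_eq_intros)
    then show "((\<lambda>t. g' (x + s *\<^sub>R u + t *\<^sub>R v) u) has_derivative
        (\<lambda>r. r * gu (x + s *\<^sub>R u + t *\<^sub>R v) v)) (at t within {0..h})"
      using lin2[OF 1] by simp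
  qed
  then obtain t where t: "0 < t" "t < h"
    and t_eq: "g' (x + s *\<^sub>R u + h *\<^sub>R v) u - g' (x + s *\<^sub>R u) u = h * gu (x + s *\<^sub>R u + t *\<^sub>R v) v"
    by auto
  have "g (x + h *\<^sub>R u + h *\<^sub>R v) - g (x + h *\<^sub>R u) - g (x + h *\<^sub>R v) + g x = \<psi> h - \<psi> 0"
    by (simp add: \<psi>_def)
  also have "\<dots> = h * h * gu (x + s *\<^sub>R u + t *\<^sub>R v) v"
    by (simp add: s_eq t_eq)
  finally show ?thesis
    using s t by (intro exI[of _ s] exI[of _ t]) auto
qed

text \<open>Swapping \<open>u\<close> and \<open>v\<close> leaves the second difference over a small
  parallelogram unchanged, so the two mixed derivatives agree at two points close to
  \<open>x\<close>. Continuity carries this equality to \<open>x\<close>.\<close>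

lemma second_derivative_symmetric_real:
  fixes g :: "'a::real_normed_vector \<Rightarrow> real"
  assumes "open S" "x \<in> S"
    and g': "\<And>y. y \<in> S \<Longrightarrow> (g has_derivative g' y) (at y)"
    and gu: "\<And>y. y \<in> S \<Longrightarrow> ((\<lambda>y. g' y u) has_derivative gu y) (at y)"
    and gv: "\<And>y. y \<in> S \<Longrightarrow> ((\<lambda>y. g' y v) has_derivative gv y) (at y)"
    and cu: "continuous_on S (\<lambda>y. gu y v)" and cv: "continuous_on S (\<lambda>y. gv y u)"
  shows "gu x v = gv x u"
proof -
  \<comment> \<open>The summand 0 gives the bound the shape that \<open>field_le_epsilon\<close>
    expects.\<close>
  have "dist (gu x v) (gv x u) \<le> 0 + e" if "e > 0" for e
  proof -
    have e: "e / 2 > 0"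
      using that by simp
    have "isCont (\<lambda>y. gu y v) x" "isCont (\<lambda>y. gv y u) x"
      using cu cv assms(1,2) by (simp_all add: continuous_on_eq_continuous_at)
    then obtain d1 d2 where d1: "d1 > 0" "\<And>y. dist y x < d1 \<Longrightarrow> dist (gu y v) (gu x v) < e / 2"
      and d2: "d2 > 0" "\<And>y. dist y x < d2 \<Longrightarrow> dist (gv y u) (gv x u) < e / 2"
      using e unfolding continuous_at_eps_delta by (metis dist_commute)
    obtain d3 where d3: "d3 > 0" "ball x d3 \<subseteq> S"
      using assms(1,2) openE by blast
    define d where "d = min d1 (min d2 d3)"
    \<comment> \<open>This size keeps the whole parallelogram within distance \<open>d\<close> of
      \<open>x\<close>; the summand 1 keeps the denominator positive when \<open>u\<close> and
      \<open>v\<close> vanish and makes the bound strict.\<close>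
    define h where "h = d / (norm u + norm v + 1)"
    have "d > 0"
      using d1 d2 d3 by (simp add: d_def)
    moreover have pos: "norm u + norm v + 1 > 0"
      by (smt (verit) norm_ge_zero)
    ultimately have h: "h > 0"
      by (simp add: h_def)
    have near: "dist (x + s *\<^sub>R u + t *\<^sub>R v) x < d"
      if "0 \<le> s" "s \<le> h" "0 \<le> t" "t \<le> h" for s t
    proof -
      have "dist (x + s *\<^sub>R u + t *\<^sub>R v) x = norm (s *\<^sub>R u + t *\<^sub>R v)"
        by (simp add: dist_norm add.assoc)
      also have "\<dots> \<le> s * norm u + t * norm v"
        using norm_triangle_ineq[of "s *\<^sub>R u" "t *\<^sub>R v"] that by simp
      also have "\<dots> \<le> h * norm u + h * norm v"
        using that by (intro add_mono mult_right_mono) auto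
      also have "\<dots> < h * (norm u + norm v + 1)"
        using h by (simp add: algebra_simps)
      also have "\<dots> = d"
        using pos by (simp add: h_def)
      finally show ?thesis .
    qed
    then have in_S: "x + s *\<^sub>R u + t *\<^sub>R v \<in> S" "x + t *\<^sub>R v + s *\<^sub>R u \<in> S"
      if "0 \<le> s" "s \<le> h" "0 \<le> t" "t \<le> h" for s t
      using d3 near[OF that] by (auto simp: d_def subset_iff dist_commute add.commute add.left_commute)
    obtain s t where st: "0 \<le> s" "s \<le> h" "0 \<le> t" "t \<le> h"
      and st_eq: "g (x + h *\<^sub>R u + h *\<^sub>R v) - g (x + h *\<^sub>R u) - g (x + h *\<^sub>R v) + g x
        = h * h * gu (x + s *\<^sub>R u + t *\<^sub>R v) v"
      using second_difference_mvt[where g = g and g' = g' and gu = gu and S = S, OF h in_S(1) g' gu] by blast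
    obtain s' t' where st': "0 \<le> s'" "s' \<le> h" "0 \<le> t'" "t' \<le> h"
      and st'_eq: "g (x + h *\<^sub>R v + h *\<^sub>R u) - g (x + h *\<^sub>R v) - g (x + h *\<^sub>R u) + g x
        = h * h * gv (x + s' *\<^sub>R v + t' *\<^sub>R u) u"
      using second_difference_mvt[where g = g and g' = g' and gu = gv and S = S and u = v and v = u, OF h in_S(2) g' gv] by blast
    have "x + h *\<^sub>R v + h *\<^sub>R u = x + h *\<^sub>R u + h *\<^sub>R v"
      by (simp add: ac_simps)
    then have "h * h * gu (x + s *\<^sub>R u + t *\<^sub>R v) v = h * h * gv (x + s' *\<^sub>R v + t' *\<^sub>R u) u"
      using st_eq st'_eq unfolding \<open>x + h *\<^sub>R v + h *\<^sub>R u = x + h *\<^sub>R u + h *\<^sub>R v\<close>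
      by linarith
    then have "gu (x + s *\<^sub>R u + t *\<^sub>R v) v = gv (x + t' *\<^sub>R u + s' *\<^sub>R v) u"
      using h by (simp add: ac_simps)
    moreover have "dist (gu (x + s *\<^sub>R u + t *\<^sub>R v) v) (gu x v) < e / 2"
      using near[OF st] by (intro d1) (simp add: d_def)
    moreover have "dist (gv (x + t' *\<^sub>R u + s' *\<^sub>R v) u) (gv x u) < e / 2"
      using near[of t' s'] st' by (intro d2) (simp add: d_def)
    ultimately show ?thesis
      unfolding dist_real_def by linarith
  qed
  then have "dist (gu x v) (gv x u) \<le> 0"
    by (rule field_le_epsilon)
  then show ?thesis
    by simp
qed

lemma smooth_on_imp_differentiable:
  assumes "smooth_on S f" "x \<in> S"
  shows "f differentiable (at x)"
  using assms unfolding smooth_on_def by (metis C_on.simps(2))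

lemma smooth_on_frechet_derivative:
  assumes "smooth_on S f"
  shows "smooth_on S (\<lambda>x. frechet_derivative f (at x) v)"
  using assms unfolding smooth_on_def by (metis C_on.simps(2))

lemma smooth_on_imp_continuous_on:
  assumes "smooth_on S f"
  shows "continuous_on S f"
  using assms unfolding smooth_on_def by (metis C_on.simps(1))

lemma smooth_on_imp_has_derivative:
  assumes "smooth_on S f" "x \<in> S"
  shows "(f has_derivative frechet_derivative f (at x)) (at x)"
  using smooth_on_imp_differentiable[OF assms] frechet_derivative_works by blast

text \<open>The real case applies to each component \<open>f y \<bullet> b\<close>.\<close>

lemma second_frechet_derivative_symmetric:
  fixes f :: "'a::real_normed_vector \<Rightarrow> 'b::euclidean_space"
  assumes "open S" "x \<in> S" "smooth_on S f"
  shows "frechet_derivative (\<lambda>y. frechet_derivative f (at y) u) (at x) v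
    = frechet_derivative (\<lambda>y. frechet_derivative f (at y) v) (at x) u"
proof (rule euclidean_eqI)
  fix b :: 'b
  note sm = smooth_on_frechet_derivative[OF assms(3)]
  show "frechet_derivative (\<lambda>y. frechet_derivative f (at y) u) (at x) v \<bullet> b
    = frechet_derivative (\<lambda>y. frechet_derivative f (at y) v) (at x) u \<bullet> b"
    by (rule second_derivative_symmetric_real[where g = "\<lambda>y. f y \<bullet> b" and S = S
        and g' = "\<lambda>y w. frechet_derivative f (at y) w \<bullet> b"
        and gu = "\<lambda>y w. frechet_derivative (\<lambda>z. frechet_derivative f (at z) u) (at y) w \<bullet> b"
        and gv = "\<lambda>y w. frechet_derivative (\<lambda>z. frechet_derivative f (at z) v) (at y) w \<bullet> b"])
      (intro assms has_derivative_inner_left smooth_on_imp_has_derivative[of S] continuous_on_inner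
        continuous_on_const smooth_on_imp_continuous_on smooth_on_frechet_derivative; assumption?)+
qed

section \<open>Vector fields under a smooth map\<close>

lemma has_derivative_frechet_derivative_apply:
  fixes \<tau> :: "'a::euclidean_space \<Rightarrow> 'b::real_normed_vector"
  assumes "open S" "x \<in> S" "smooth_on S \<tau>" "(F has_derivative F') (at x)"
  shows "((\<lambda>y. frechet_derivative \<tau> (at y) (F y)) has_derivative
    (\<lambda>v. frechet_derivative \<tau> (at x) (F' v)
       + frechet_derivative (\<lambda>y. frechet_derivative \<tau> (at y) (F x)) (at x) v)) (at x)"
proof -
  \<comment> \<open>Expanding in the basis turns the moving argument of the derivative into scalar
    coefficients, so the product rule for scalar multiples suffices.\<close>
  have expand: "frechet_derivative \<tau> (at y) w = (\<Sum>b\<in>Basis. (w \<bullet> b) *\<^sub>R frechet_derivative \<tau> (at y) b)"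
    if "y \<in> S" for y w
  proof -
    interpret linear "frechet_derivative \<tau> (at y)"
      using smooth_on_imp_has_derivative[OF assms(3) that] by (rule has_derivative_linear)
    have "frechet_derivative \<tau> (at y) w = frechet_derivative \<tau> (at y) (\<Sum>b\<in>Basis. (w \<bullet> b) *\<^sub>R b)"
      by (simp only: euclidean_representation)
    then show ?thesis
      by (simp only: sum scale)
  qed
  have D: "((\<lambda>y. \<Sum>b\<in>Basis. (G y \<bullet> b) *\<^sub>R frechet_derivative \<tau> (at y) b) has_derivative
      (\<lambda>v. \<Sum>b\<in>Basis. (G x \<bullet> b) *\<^sub>R frechet_derivative (\<lambda>y. frechet_derivative \<tau> (at y) b) (at x) v
        + (G' v \<bullet> b) *\<^sub>R frechet_derivative \<tau> (at x) b)) (at x)"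
    if "(G has_derivative G') (at x)" for G G'
    by (intro has_derivative_sum has_derivative_scaleR has_derivative_inner_left that
        smooth_on_imp_has_derivative[of S] smooth_on_frechet_derivative assms)
  have D': "((\<lambda>y. frechet_derivative \<tau> (at y) (G y)) has_derivative
      (\<lambda>v. \<Sum>b\<in>Basis. (G x \<bullet> b) *\<^sub>R frechet_derivative (\<lambda>y. frechet_derivative \<tau> (at y) b) (at x) v
        + (G' v \<bullet> b) *\<^sub>R frechet_derivative \<tau> (at x) b)) (at x)"
    if "(G has_derivative G') (at x)" for G G'
    by (rule has_derivative_transform_within_open[OF D[OF that] assms(1,2)]) (simp add: expand[symmetric])
  \<comment> \<open>The same rule for the constant field \<open>F x\<close> identifies the sum of
    second-order terms.\<close>
  have "frechet_derivative (\<lambda>y. frechet_derivative \<tau> (at y) (F x)) (at x) v =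
      (\<Sum>b\<in>Basis. (F x \<bullet> b) *\<^sub>R frechet_derivative (\<lambda>y. frechet_derivative \<tau> (at y) b) (at x) v)" for v
    by (subst frechet_derivative_at[OF D'[OF has_derivative_const[of "F x"]], symmetric]) simp
  then show ?thesis
    using D'[OF assms(4)] by (simp add: sum.distrib expand[OF assms(2), symmetric] add.commute)
qed

text \<open>The second derivatives of \<open>\<tau>\<close> cancel by symmetry.\<close>

lemma bracket_push_forward:
  fixes \<tau> :: "'a::euclidean_space \<Rightarrow> 'b::euclidean_space"
  assumes S: "open S" "x \<in> S" "smooth_on S \<tau>"
    and F: "F differentiable (at x)" "F' differentiable (at (\<tau> x))"
    and G: "G differentiable (at x)" "G' differentiable (at (\<tau> x))"
    and F_eq: "\<And>y. y \<in> S \<Longrightarrow> F' (\<tau> y) = frechet_derivative \<tau> (at y) (F y)"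
    and G_eq: "\<And>y. y \<in> S \<Longrightarrow> G' (\<tau> y) = frechet_derivative \<tau> (at y) (G y)"
  shows "frechet_derivative G' (at (\<tau> x)) (F' (\<tau> x)) - frechet_derivative F' (at (\<tau> x)) (G' (\<tau> x))
    = frechet_derivative \<tau> (at x)
        (frechet_derivative G (at x) (F x) - frechet_derivative F (at x) (G x))"
proof -
  \<comment> \<open>The relation between \<open>H'\<close> and \<open>H\<close> is differentiated in
    two ways, by the chain rule on the left and by the product rule on the right. The last summand
    is the second derivative of \<open>\<tau>\<close> in the directions \<open>H x\<close> and
    \<open>v\<close>.\<close>
  have chain: "frechet_derivative H' (at (\<tau> x)) (frechet_derivative \<tau> (at x) v) =
      frechet_derivative \<tau> (at x) (frechet_derivative H (at x) v)
       + frechet_derivative (\<lambda>y. frechet_derivative \<tau> (at y) (H x)) (at x) v"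
    if H: "H differentiable (at x)" "H' differentiable (at (\<tau> x))"
      and H_eq: "\<And>y. y \<in> S \<Longrightarrow> H' (\<tau> y) = frechet_derivative \<tau> (at y) (H y)" for H H' v
  proof -
    have DH: "(H has_derivative frechet_derivative H (at x)) (at x)"
      and DH': "(H' has_derivative frechet_derivative H' (at (\<tau> x))) (at (\<tau> x))"
      using H frechet_derivative_works by blast+
    have "((\<lambda>y. H' (\<tau> y)) has_derivative
        (\<lambda>v. frechet_derivative H' (at (\<tau> x)) (frechet_derivative \<tau> (at x) v))) (at x)"
      by (rule has_derivative_compose[OF smooth_on_imp_has_derivative[OF S(3,2)] DH'])
    moreover have "((\<lambda>y. H' (\<tau> y)) has_derivative
        (\<lambda>v. frechet_derivative \<tau> (at x) (frechet_derivative H (at x) v)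
       + frechet_derivative (\<lambda>y. frechet_derivative \<tau> (at y) (H x)) (at x) v)) (at x)"
      by (rule has_derivative_transform_within_open[
            OF has_derivative_frechet_derivative_apply[OF S DH] S(1,2)]) (simp add: H_eq)
    ultimately have "(\<lambda>v. frechet_derivative H' (at (\<tau> x)) (frechet_derivative \<tau> (at x) v)) =
        (\<lambda>v. frechet_derivative \<tau> (at x) (frechet_derivative H (at x) v)
         + frechet_derivative (\<lambda>y. frechet_derivative \<tau> (at y) (H x)) (at x) v)"
      by (rule has_derivative_unique)
    then show ?thesis
      by (rule fun_cong)
  qed
  have "linear (frechet_derivative \<tau> (at x))"
    using smooth_on_imp_has_derivative[OF S(3,2)] has_derivative_linear by blast
  then show ?thesis
    using chain[OF G G_eq, of "F x"] chain[OF F F_eq, of "G x"]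
      second_frechet_derivative_symmetric[OF S, of "F x" "G x"]
    by (simp add: F_eq[OF S(2)] G_eq[OF S(2)] linear_diff)
qed

text \<open>
  The coefficients of \<open>F\<close> in the frame \<open>L\<close> are \<open>O(|y - x|)\<close>, so the component of \<open>F\<close> orthogonal to
  the range of \<open>L x\<close> is \<open>o(|y - x|)\<close>.
\<close>

lemma derivative_in_range:
  fixes L :: "'e::real_normed_vector \<Rightarrow> 'k::euclidean_space \<Rightarrow> 'f::euclidean_space"
  assumes S: "open S" "x \<in> S"
    and lin: "\<And>y. y \<in> S \<Longrightarrow> linear (L y)" and inj: "inj (L x)"
    and cont: "\<And>k. isCont (\<lambda>y. L y k) x"
    and F: "\<And>y. y \<in> S \<Longrightarrow> F y \<in> range (L y)" and F0: "F x = 0"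
    and F': "(F has_derivative F') (at x)"
  shows "F' v \<in> range (L x)"
proof -
  obtain B where B: "B > 0" "\<And>k. B * norm k \<le> norm (L x k)"
    using linear_inj_bounded_below_pos[OF lin[OF S(2)] inj] by blast
  \<comment> \<open>\<open>\<omega> y\<close> bounds the operator norm of \<open>L y - L x\<close>
    and tends to 0 at \<open>x\<close>.\<close>
  define \<omega> where "\<omega> y = (\<Sum>b\<in>Basis. norm (L y b - L x b))" for y
  have \<omega>: "norm (L y k - L x k) \<le> norm k * \<omega> y" if "y \<in> S" for y k
  proof -
    have "L z k = (\<Sum>b\<in>Basis. (k \<bullet> b) *\<^sub>R L z b)" if "z \<in> S" for z
    proof -
      interpret linear "L z" by (rule lin[OF that])
      have "L z k = L z (\<Sum>b\<in>Basis. (k \<bullet> b) *\<^sub>R b)"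
        by (simp only: euclidean_representation)
      then show ?thesis
        by (simp only: sum scale)
    qed
    then have "L y k - L x k = (\<Sum>b\<in>Basis. (k \<bullet> b) *\<^sub>R (L y b - L x b))"
      using that S(2) by (simp add: sum_subtractf scaleR_diff_right)
    also have "norm \<dots> \<le> (\<Sum>b\<in>Basis. norm k * norm (L y b - L x b))"
      by (intro sum_norm_le) (simp add: Basis_le_norm mult_right_mono)
    finally show ?thesis
      by (simp add: \<omega>_def sum_distrib_left)
  qed
  have "((\<lambda>y. \<Sum>b\<in>Basis. norm (L y b - L x b)) \<longlongrightarrow> (\<Sum>b\<in>Basis. norm (L x b - L x b))) (at x)"
    using cont unfolding isCont_def by (intro tendsto_sum tendsto_norm tendsto_diff tendsto_const) auto
  then have \<omega>_lim: "(\<omega> \<longlongrightarrow> 0) (at x)"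
    by (simp add: \<omega>_def[abs_def])
  have \<omega>_small: "\<exists>d>0. \<forall>y. norm (y - x) < d \<longrightarrow> \<omega> y < e" if e: "e > 0" for e
  proof -
    obtain d where "d > 0" "\<And>y. y \<noteq> x \<Longrightarrow> dist y x < d \<Longrightarrow> dist (\<omega> y) 0 < e"
      using tendstoD[OF \<omega>_lim e] unfolding eventually_at by blast
    moreover have "\<omega> x = 0"
      by (simp add: \<omega>_def)
    ultimately show ?thesis
      using e by (intro exI[of _ d]) (metis abs_less_iff dist_norm dist_real_def diff_zero)
  qed
  \<comment> \<open>Since \<open>n\<close> annihilates the range of \<open>L x\<close>, only
    \<open>L y k - L x k\<close> contributes to \<open>n \<bullet> F y\<close>. This is at most
    \<open>norm k * \<omega> y\<close> up to the factor \<open>norm n\<close>, a quantity of order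
    \<open>norm (y - x)\<close> times one that tends to 0.\<close>
  have ortho: "n \<bullet> F' v = 0" if n: "\<And>k. n \<bullet> L x k = 0" for n
  proof -
    obtain K where K: "K > 0" "\<And>w. norm (F' w) \<le> norm w * K"
      using bounded_linear.pos_bounded[OF has_derivative_bounded_linear[OF F']] by blast
    obtain d1 where d1: "d1 > 0"
      "\<And>y. norm (y - x) < d1 \<Longrightarrow> norm (F y - F x - F' (y - x)) \<le> 1 * norm (y - x)"
      using F' unfolding has_derivative_at_alt by (meson zero_less_one)
    obtain d2 where d2: "d2 > 0" "ball x d2 \<subseteq> S"
      using S openE by blast
    obtain d3 where d3: "d3 > 0" "\<And>y. norm (y - x) < d3 \<Longrightarrow> \<omega> y < B / 2"
      using \<omega>_small[of "B / 2"] B(1) by auto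
    have bound: "\<bar>n \<bullet> F y\<bar> \<le> (norm n * (2 / B) * (K + 1)) * \<omega> y * norm (y - x)"
      if y: "norm (y - x) < Min {d1, d2, d3}" for y
    proof -
      have yS: "y \<in> S"
        using y d2(2) by (auto simp: subset_iff dist_norm norm_minus_commute)
      have \<omega>0: "\<omega> y \<ge> 0"
        unfolding \<omega>_def by (intro sum_nonneg) simp
      obtain k where k: "F y = L y k"
        using F[OF yS] by blast
      \<comment> \<open>As \<open>\<omega> y < B / 2\<close>, the perturbation costs at most half of
        the lower bound for \<open>L x\<close>, so \<open>norm k\<close> is controlled by
        \<open>norm (F y)\<close>.\<close>
      have "B * norm k \<le> norm (L y k) + norm (L y k - L x k)"
        using B(2)[of k] norm_triangle_sub[of "L x k" "L y k"] by (simp add: norm_minus_commute)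
      also have "\<dots> \<le> norm (F y) + norm k * (B / 2)"
        using \<omega>[OF yS, of k] d3(2)[of y] y k mult_left_mono[of "\<omega> y" "B / 2" "norm k"] by auto
      finally have k_le: "norm k \<le> (2 / B) * norm (F y)"
        using B(1) by (simp add: field_simps)
      have "norm (F y) \<le> norm (F' (y - x)) + norm (F y - F x - F' (y - x))"
        using norm_triangle_sub[of "F y" "F' (y - x)"] by (simp add: F0)
      also have "\<dots> \<le> (K + 1) * norm (y - x)"
        using K(2)[of "y - x"] d1(2)[of y] y by (simp add: algebra_simps)
      finally have F_le: "norm (F y) \<le> (K + 1) * norm (y - x)" .
      have "n \<bullet> F y = n \<bullet> (L y k - L x k)"
        by (simp add: k inner_diff_right n)
      then have "\<bar>n \<bullet> F y\<bar> \<le> norm n * norm (L y k - L x k)"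
        using Cauchy_Schwarz_ineq2 by metis
      also have "\<dots> \<le> norm n * (norm k * \<omega> y)"
        using \<omega>[OF yS] by (intro mult_left_mono) auto
      also have "\<dots> \<le> norm n * (((2 / B) * ((K + 1) * norm (y - x))) * \<omega> y)"
        using k_le F_le B(1) \<omega>0
        by (intro mult_left_mono mult_right_mono order_trans[OF k_le]) auto
      finally show ?thesis
        by (simp only: mult.assoc mult.commute mult.left_commute)
    qed
    \<comment> \<open>The summand 1 makes \<open>C\<close> positive even for \<open>n = 0\<close>,
      so that \<open>e / C\<close> is a legitimate threshold.\<close>
    define C where "C = norm n * (2 / B) * (K + 1) + 1"
    have C: "C > 0" "C \<ge> norm n * (2 / B) * (K + 1)"
      using K(1) B(1) by (auto simp: C_def intro!: add_nonneg_pos)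
    have "((\<lambda>y. n \<bullet> F y) has_derivative (\<lambda>_. 0)) (at x)"
      unfolding has_derivative_at_alt
    proof (intro conjI allI impI bounded_linear_zero)
      fix e :: real assume "e > 0"
      then obtain d4 where d4: "d4 > 0" "\<And>y. norm (y - x) < d4 \<Longrightarrow> \<omega> y < e / C"
        using \<omega>_small[of "e / C"] C(1) by auto
      show "\<exists>d>0. \<forall>y. norm (y - x) < d \<longrightarrow> norm (n \<bullet> F y - n \<bullet> F x - 0) \<le> e * norm (y - x)"
      proof (intro exI[of _ "Min {d1, d2, d3, d4}"] conjI allI impI)
        show "Min {d1, d2, d3, d4} > 0"
          using d1 d2 d3 d4 by simp
        fix y assume y: "norm (y - x) < Min {d1, d2, d3, d4}"
        have "\<omega> y \<ge> 0"
          unfolding \<omega>_def by (intro sum_nonneg) simp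
        have "\<bar>n \<bullet> F y\<bar> \<le> (norm n * (2 / B) * (K + 1)) * \<omega> y * norm (y - x)"
          using y by (intro bound) auto
        also have "\<dots> \<le> C * \<omega> y * norm (y - x)"
          using C(2) \<open>\<omega> y \<ge> 0\<close> by (intro mult_right_mono) auto
        also have "\<dots> \<le> e * norm (y - x)"
          using d4(2)[of y] y C(1) by (intro mult_right_mono) (auto simp: field_simps)
        finally show "norm (n \<bullet> F y - n \<bullet> F x - 0) \<le> e * norm (y - x)"
          by (simp add: F0)
      qed
    qed
    moreover have "((\<lambda>y. n \<bullet> F y) has_derivative (\<lambda>w. n \<bullet> F' w)) (at x)"
      by (rule has_derivative_inner_right[OF F'])
    ultimately have "(\<lambda>_. 0) = (\<lambda>w. n \<bullet> F' w)"
      by (rule has_derivative_unique)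
    from fun_cong[OF this, of v] show ?thesis
      by simp
  qed
  have sub: "span (range (L x)) = range (L x)"
    using linear_subspace_image[OF lin[OF S(2)] subspace_UNIV] by (simp add: span_eq_iff)
  \<comment> \<open>The component \<open>z\<close> of \<open>F' v\<close> normal to the range of
    \<open>L x\<close> is orthogonal to \<open>F' v\<close> by \<open>ortho\<close> and to
    \<open>y\<close> by construction, hence to itself.\<close>
  obtain y z where yz: "y \<in> span (range (L x))" "\<And>w. w \<in> span (range (L x)) \<Longrightarrow> orthogonal z w"
    "F' v = y + z"
    using orthogonal_subspace_decomp_exists by metis
  have zL: "z \<bullet> L x k = 0" for k
    using yz(2) by (simp add: sub orthogonal_def)
  moreover have "z \<bullet> y = 0"
    using yz(1,2) by (simp add: orthogonal_def)
  ultimately have "z \<bullet> z = 0"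
    using ortho[OF zL] yz(3) by (simp add: inner_add_right)
  then show ?thesis
    using yz by (simp add: sub)
qed

text \<open>With \<open>F x = L x \<alpha>\<close> and \<open>G x = L x \<beta>\<close>, the fields
  \<open>F y - L y \<alpha>\<close> and \<open>G y - L y \<beta>\<close> lie in the range of
  \<open>L y\<close> and vanish at \<open>x\<close>, so \<open>derivative_in_range\<close> applies
  to both. Freezing the coefficients at \<open>x\<close> avoids differentiating the coefficient
  functions of \<open>F\<close> and \<open>G\<close>.\<close>

lemma bracket_in_range:
  fixes L :: "'e::euclidean_space \<Rightarrow> 'k::euclidean_space \<Rightarrow> 'e"
  assumes S: "open S" "x \<in> S"
    and lin: "\<And>y. y \<in> S \<Longrightarrow> linear (L y)" and inj: "inj (L x)"
    and diff: "\<And>k. (\<lambda>y. L y k) differentiable (at x)"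
    and F: "\<And>y. y \<in> S \<Longrightarrow> F y \<in> range (L y)" "(F has_derivative F') (at x)"
    and G: "\<And>y. y \<in> S \<Longrightarrow> G y \<in> range (L y)" "(G has_derivative G') (at x)"
  shows "\<exists>\<alpha> \<beta>. G' (F x) - F' (G x) -
    (frechet_derivative (\<lambda>y. L y \<beta>) (at x) (L x \<alpha>) - frechet_derivative (\<lambda>y. L y \<alpha>) (at x) (L x \<beta>))
    \<in> range (L x)"
proof -
  interpret Lx: linear "L x"
    by (rule lin[OF S(2)])
  have sub: "subspace (range (L x))"
    using linear_subspace_image[OF lin[OF S(2)] subspace_UNIV] .
  have cont: "isCont (\<lambda>y. L y k) x" for k
    using differentiable_imp_continuous_within[OF diff] .
  have *: "H' v - frechet_derivative (\<lambda>y. L y k) (at x) v \<in> range (L x)"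
    if H: "\<And>y. y \<in> S \<Longrightarrow> H y \<in> range (L y)" "(H has_derivative H') (at x)" and k: "H x = L x k"
    for H H' k v
  proof (rule derivative_in_range[OF S lin inj cont, where F = "\<lambda>y. H y - L y k"
        and F' = "\<lambda>v. H' v - frechet_derivative (\<lambda>y. L y k) (at x) v"])
    show "H y - L y k \<in> range (L y)" if y: "y \<in> S" for y
      using subspace_diff[OF linear_subspace_image[OF lin[OF y] subspace_UNIV] H(1)[OF y] rangeI] .
    show "((\<lambda>y. H y - L y k) has_derivative (\<lambda>v. H' v - frechet_derivative (\<lambda>y. L y k) (at x) v)) (at x)"
      using diff[of k] frechet_derivative_works H(2) by (intro has_derivative_diff) blast+
  qed (simp_all add: k)
  obtain \<alpha> \<beta> where ab: "F x = L x \<alpha>" "G x = L x \<beta>"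
    using F(1) G(1) S(2) by blast
  have "G' (F x) - F' (G x) -
    (frechet_derivative (\<lambda>y. L y \<beta>) (at x) (L x \<alpha>) - frechet_derivative (\<lambda>y. L y \<alpha>) (at x) (L x \<beta>))
    \<in> range (L x)"
    using subspace_diff[OF sub *[OF G ab(2), of "L x \<alpha>"] *[OF F ab(1), of "L x \<beta>"]]
    by (simp add: ab algebra_simps)
  then show ?thesis
    by blast
qed

section \<open>Tangent vectors and Lie brackets in charts\<close>

lemma sum_fun_apply: "(\<Sum>i\<in>I. f i) x = (\<Sum>i\<in>I. f i x)"
  by (induction I rule: infinite_finite_induct) auto

lemma span_range_subset:
  fixes F :: "'k::finite \<Rightarrow> 'v::real_vector"
  shows "span (range F) \<subseteq> range (\<lambda>u. \<Sum>i\<in>UNIV. u i *\<^sub>R F i)"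
proof (rule span_minimal)
  have "F i = (\<Sum>j\<in>UNIV. (if j = i then 1 else 0) *\<^sub>R F j)" for i
    by (simp add: if_distrib[of "\<lambda>r. r *\<^sub>R _"] cong: if_cong)
  then show "range F \<subseteq> range (\<lambda>u. \<Sum>i\<in>UNIV. u i *\<^sub>R F i)"
    by (intro image_subsetI) (rule range_eqI)
  show "subspace (range (\<lambda>u. \<Sum>i\<in>UNIV. u i *\<^sub>R F i))"
    unfolding subspace_def
  proof (intro conjI ballI allI)
    show "0 \<in> range (\<lambda>u. \<Sum>i\<in>UNIV. u i *\<^sub>R F i)"
      by (intro range_eqI[of _ _ "\<lambda>_. 0"]) simp
  next
    fix v w
    assume "v \<in> range (\<lambda>u. \<Sum>i\<in>UNIV. u i *\<^sub>R F i)" "w \<in> range (\<lambda>u. \<Sum>i\<in>UNIV. u i *\<^sub>R F i)"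
    then obtain a b where "v = (\<Sum>i\<in>UNIV. a i *\<^sub>R F i)" "w = (\<Sum>i\<in>UNIV. b i *\<^sub>R F i)"
      by blast
    then show "v + w \<in> range (\<lambda>u. \<Sum>i\<in>UNIV. u i *\<^sub>R F i)"
      by (intro range_eqI[of _ _ "\<lambda>i. a i + b i"]) (simp add: scaleR_add_left sum.distrib)
  next
    fix r v
    assume "v \<in> range (\<lambda>u. \<Sum>i\<in>UNIV. u i *\<^sub>R F i)"
    then obtain a where "v = (\<Sum>i\<in>UNIV. a i *\<^sub>R F i)"
      by blast
    then show "r *\<^sub>R v \<in> range (\<lambda>u. \<Sum>i\<in>UNIV. u i *\<^sub>R F i)"
      by (intro range_eqI[of _ _ "\<lambda>i. r * a i"]) (simp add: scaleR_sum_right)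
  qed
qed

section \<open>Charts and transition maps\<close>

context
  fixes M :: "'m topology" and A :: "('m, 'e::euclidean_space) chart set"
  assumes M: "smooth_manifold M A"
begin

lemma chart_open:
  assumes "c \<in> A"
  shows "openin M (fst c)" "open (snd c ` fst c)"
    and "homeomorphic_map (subtopology M (fst c)) (top_of_set (snd c ` fst c)) (snd c)"
proof -
  have "\<forall>(U, \<phi>)\<in>A. openin M U \<and> open (\<phi> ` U) \<and>
      homeomorphic_map (subtopology M U) (top_of_set (\<phi> ` U)) \<phi>"
    using M unfolding smooth_manifold_def by (elim conjE)
  from bspec[OF this assms] show "openin M (fst c)" "open (snd c ` fst c)"
    "homeomorphic_map (subtopology M (fst c)) (top_of_set (snd c ` fst c)) (snd c)"
    by (simp_all add: case_prod_beta)
qed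

lemma topspace_eq: "topspace M = \<Union> (fst ` A)"
  using M unfolding smooth_manifold_def by (elim conjE)

lemma chart_inj:
  assumes "c \<in> A"
  shows "inj_on (snd c) (fst c)"
proof -
  have "topspace (subtopology M (fst c)) = fst c"
    using openin_subset[OF chart_open(1)[OF assms]] by auto
  then show ?thesis
    using homeomorphic_imp_injective_map[OF chart_open(3)[OF assms]] by simp
qed

lemma chart_inv_chart [simp]:
  assumes "c \<in> A" "q \<in> fst c"
  shows "chart_inv c (snd c q) = q"
  unfolding chart_inv_def by (rule inv_into_f_f[OF chart_inj[OF assms(1)] assms(2)])

lemma transition_chart:
  assumes "c \<in> A" "q \<in> fst c"
  shows "transition c d (snd c q) = snd d q"
  using assms by (simp add: transition_def)

lemma open_chart_image:
  assumes "c \<in> A" "openin M U" "U \<subseteq> fst c"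
  shows "open (snd c ` U)"
proof -
  have "openin (subtopology M (fst c)) U"
    using assms by (metis inf.absorb_iff1 openin_subtopology)
  then have "openin (top_of_set (snd c ` fst c)) (snd c ` U)"
    using homeomorphic_imp_open_map[OF chart_open(3)[OF assms(1)]] unfolding open_map_def by blast
  then show ?thesis
    using chart_open(2)[OF assms(1)] openin_open_eq by blast
qed

lemma open_overlap:
  assumes "c \<in> A" "d \<in> A"
  shows "open (snd c ` (fst c \<inter> fst d))"
  using assms by (intro open_chart_image openin_Int chart_open) auto

lemma smooth_transition:
  assumes "c \<in> A" "d \<in> A"
  shows "smooth_on (snd c ` (fst c \<inter> fst d)) (transition c d)"
proof -
  have "\<forall>c\<in>A. \<forall>d\<in>A. smooth_on (snd c ` (fst c \<inter> fst d)) (transition c d)"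
    using M unfolding smooth_manifold_def by (elim conjE)
  then show ?thesis
    using assms by blast
qed

lemma transition_has_derivative:
  assumes "c \<in> A" "d \<in> A" "q \<in> fst c" "q \<in> fst d"
  shows "(transition c d has_derivative frechet_derivative (transition c d) (at (snd c q))) (at (snd c q))"
  using assms by (intro smooth_on_imp_has_derivative[OF smooth_transition]) auto

text \<open>The map \<open>transition c c\<close> is the identity only on the chart image, outside
  which \<open>chart_inv\<close> is arbitrary. The image is open, so the derivative does not see the
  difference.\<close>

lemma transition_self_derivative:
  assumes "c \<in> A" "q \<in> fst c"
  shows "frechet_derivative (transition c c) (at (snd c q)) = (\<lambda>w. w)"
proof (rule frechet_derivative_at[symmetric])
  show "(transition c c has_derivative (\<lambda>w. w)) (at (snd c q))"
    by (rule has_derivative_transform_within_open[OF has_derivative_ident chart_open(2)[OF assms(1)]])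
      (use assms in \<open>auto simp: transition_chart\<close>)
qed

lemma transition_cocycle:
  assumes "c \<in> A" "d \<in> A" "e \<in> A" "q \<in> fst c" "q \<in> fst d" "q \<in> fst e"
  shows "frechet_derivative (transition d e) (at (snd d q))
      (frechet_derivative (transition c d) (at (snd c q)) w)
    = frechet_derivative (transition c e) (at (snd c q)) w"
proof -
  have op: "open (snd c ` (fst c \<inter> fst d \<inter> fst e))"
    using assms by (intro open_chart_image openin_Int chart_open) auto
  have "((\<lambda>y. transition d e (transition c d y)) has_derivative
      (\<lambda>w. frechet_derivative (transition d e) (at (snd d q))
        (frechet_derivative (transition c d) (at (snd c q)) w))) (at (snd c q))"
    using has_derivative_compose[OF transition_has_derivative, of c d q "transition d e"]
      transition_has_derivative[of d e q] assms by (simp add: transition_chart)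
  then have "(transition c e has_derivative
      (\<lambda>w. frechet_derivative (transition d e) (at (snd d q))
        (frechet_derivative (transition c d) (at (snd c q)) w))) (at (snd c q))"
    by (rule has_derivative_transform_within_open[OF _ op]) (use assms in \<open>auto simp: transition_chart\<close>)
  then show ?thesis
    by (rule fun_cong[OF frechet_derivative_at])
qed

section \<open>Tangent spaces\<close>

lemma tangent_spaceI:
  assumes "\<And>c. \<not> (c \<in> A \<and> q \<in> fst c) \<Longrightarrow> v c = 0"
    and "\<And>c d. c \<in> A \<Longrightarrow> d \<in> A \<Longrightarrow> q \<in> fst c \<Longrightarrow> q \<in> fst d \<Longrightarrow>
      v d = frechet_derivative (transition c d) (at (snd c q)) (v c)"
  shows "v \<in> tangent_space A q"
  using assms unfolding tangent_space_def by blast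

lemma tangent_space_zero:
  assumes "v \<in> tangent_space A q" "\<not> (c \<in> A \<and> q \<in> fst c)"
  shows "v c = 0"
  using assms unfolding tangent_space_def by blast

lemma tangent_space_transition:
  assumes "v \<in> tangent_space A q" "c \<in> A" "d \<in> A" "q \<in> fst c" "q \<in> fst d"
  shows "v d = frechet_derivative (transition c d) (at (snd c q)) (v c)"
  using assms unfolding tangent_space_def by blast

lemma subspace_tangent_space: "subspace (tangent_space A q)"
proof -
  have lin: "linear (frechet_derivative (transition c d) (at (snd c q)))"
    if "c \<in> A" "d \<in> A" "q \<in> fst c" "q \<in> fst d" for c d
    using transition_has_derivative[OF that] by (rule has_derivative_linear)
  show ?thesis
  proof (rule subspaceI)
    show "0 \<in> tangent_space A q"
      by (rule tangent_spaceI) (simp_all add: linear_0[OF lin])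
  next
    fix v w
    assume vw: "v \<in> tangent_space A q" "w \<in> tangent_space A q"
    show "v + w \<in> tangent_space A q"
    proof (rule tangent_spaceI)
      fix c d
      assume "c \<in> A" "d \<in> A" "q \<in> fst c" "q \<in> fst d"
      then show "(v + w) d = frechet_derivative (transition c d) (at (snd c q)) ((v + w) c)"
        using vw[THEN tangent_space_transition, of c d] linear_add[OF lin, of c d] by simp
    qed (use vw[THEN tangent_space_zero] in simp)
  next
    fix r v
    assume v: "v \<in> tangent_space A q"
    show "r *\<^sub>R v \<in> tangent_space A q"
    proof (rule tangent_spaceI)
      fix c d
      assume "c \<in> A" "d \<in> A" "q \<in> fst c" "q \<in> fst d"
      then show "(r *\<^sub>R v) d = frechet_derivative (transition c d) (at (snd c q)) ((r *\<^sub>R v) c)"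
        using tangent_space_transition[OF v, of c d] linear_scale[OF lin, of c d] by simp
    qed (use tangent_space_zero[OF v] in simp)
  qed
qed

text \<open>One representative determines the others through the Jacobians, and the remaining values
  are 0 by convention. Identities between tangent vectors thus reduce to a single chart.\<close>

lemma tangent_space_eqI:
  assumes "v \<in> tangent_space A q" "w \<in> tangent_space A q" "c \<in> A" "q \<in> fst c" "v c = w c"
  shows "v = w"
proof
  fix d
  show "v d = w d"
    using assms(5) tangent_space_zero[OF assms(1)] tangent_space_zero[OF assms(2)]
      tangent_space_transition[OF assms(1,3) _ assms(4)]
      tangent_space_transition[OF assms(2,3) _ assms(4)] by metis
qed

lemma coord_vector_self [simp]:
  assumes "c \<in> A" "q \<in> fst c"
  shows "coord_vector A c q w c = w"
  using assms by (simp add: coord_vector_def transition_self_derivative)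

lemma coord_vector_in_tangent_space:
  assumes "c \<in> A" "q \<in> fst c"
  shows "coord_vector A c q w \<in> tangent_space A q"
  using assms by (intro tangent_spaceI) (auto simp: coord_vector_def transition_cocycle)

lemma tangent_eq_sum_coord_vector:
  assumes "v \<in> tangent_space A q" "c \<in> A" "q \<in> fst c"
  shows "v = (\<Sum>b\<in>Basis. (v c \<bullet> b) *\<^sub>R coord_vector A c q b)"
proof (rule tangent_space_eqI[OF assms(1) _ assms(2,3)])
  show "(\<Sum>b\<in>Basis. (v c \<bullet> b) *\<^sub>R coord_vector A c q b) \<in> tangent_space A q"
    by (intro subspace_sum subspace_scale subspace_tangent_space coord_vector_in_tangent_space assms)
  have "(\<Sum>b\<in>Basis. (v c \<bullet> b) *\<^sub>R coord_vector A c q b) c = (\<Sum>b\<in>Basis. (v c \<bullet> b) *\<^sub>R b)"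
    using assms(2,3) by (simp add: sum_fun_apply)
  then show "v c = (\<Sum>b\<in>Basis. (v c \<bullet> b) *\<^sub>R coord_vector A c q b) c"
    by (simp add: euclidean_representation)
qed

section \<open>Lie brackets and distributions with a frame\<close>

lemma smooth_vfield_tangent:
  assumes "smooth_vfield A f" "c \<in> A" "q \<in> fst c"
  shows "f q \<in> tangent_space A q"
  using assms unfolding smooth_vfield_def by blast

lemma local_rep_chart [simp]:
  assumes "c \<in> A" "q \<in> fst c"
  shows "local_rep c f (snd c q) = f q c"
  using assms by (simp add: local_rep_def)

lemma local_rep_has_derivative:
  assumes "smooth_vfield A f" "c \<in> A" "q \<in> fst c"
  shows "(local_rep c f has_derivative frechet_derivative (local_rep c f) (at (snd c q))) (at (snd c q))"
  using assms unfolding smooth_vfield_def by (intro smooth_on_imp_has_derivative) auto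

text \<open>On an overlap the local representatives are related by the Jacobian of the transition
  map, so \<open>bracket_push_forward\<close> gives the transformation law of the bracket.\<close>

lemma lie_bracket_in_tangent_space:
  assumes f: "smooth_vfield A f" and g: "smooth_vfield A g"
  shows "lie_bracket A f g q \<in> tangent_space A q"
proof -
  have transform: "lie_bracket A f g q d =
      frechet_derivative (transition c d) (at (snd c q)) (lie_bracket A f g q c)"
    if c: "c \<in> A" "q \<in> fst c" and d: "d \<in> A" "q \<in> fst d" for c d
  proof -
    have rep: "local_rep d h (transition c d y) =
        frechet_derivative (transition c d) (at y) (local_rep c h y)"
      if h: "smooth_vfield A h" and y: "y \<in> snd c ` (fst c \<inter> fst d)" for h y
    proof -
      obtain r where r: "y = snd c r" "r \<in> fst c" "r \<in> fst d"
        using y by blast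
      show ?thesis
        using tangent_space_transition[OF smooth_vfield_tangent[OF h c(1) r(2)], of c d] r c(1) d(1)
        by (simp add: transition_chart)
    qed
    have diff: "local_rep k h differentiable (at (snd k q))"
      if "smooth_vfield A h" "k \<in> A" "q \<in> fst k" for h k
      using local_rep_has_derivative[OF that] differentiableI by blast
    show ?thesis
      using bracket_push_forward[OF open_overlap[OF c(1) d(1)] _ smooth_transition[OF c(1) d(1)]
          diff[OF f c] _ diff[OF g c] _ rep[OF f] rep[OF g]] diff[OF f d] diff[OF g d] c d
      by (simp add: lie_bracket_def transition_chart)
  qed
  show ?thesis
  proof (rule tangent_spaceI)
    fix c
    assume "\<not> (c \<in> A \<and> q \<in> fst c)"
    then show "lie_bracket A f g q c = 0"
      unfolding lie_bracket_def by (rule if_not_P)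
  qed (rule transform)
qed

lemma lie_bracket_chart:
  assumes "c \<in> A" "q \<in> fst c"
  shows "lie_bracket A f g q c = frechet_derivative (local_rep c g) (at (snd c q)) (f q c)
    - frechet_derivative (local_rep c f) (at (snd c q)) (g q c)"
  using assms by (simp add: lie_bracket_def)

text \<open>In a chart, sections are combinations of the frame, and \<open>bracket_in_range\<close>
  replaces their coefficients by the values at \<open>q\<close> modulo the span of the frame. What
  remains is the bilinear expression in the brackets of the frame fields.\<close>

lemma lie_bracket_in_frame_span:
  fixes f :: "'k::finite \<Rightarrow> ('m, 'e) vfield"
  assumes f: "\<And>i. smooth_vfield A (f i)" and q: "q \<in> topspace M"
    and indep: "\<And>a. (\<Sum>i\<in>UNIV. a i *\<^sub>R f i q) = 0 \<Longrightarrow> \<forall>i. a i = 0"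
    and g: "g \<in> sections A (span_distr (range f))" and h: "h \<in> sections A (span_distr (range f))"
  shows "lie_bracket A g h q \<in>
    span (range (\<lambda>i. f i q) \<union> range (\<lambda>(i, j). lie_bracket A (f i) (f j) q))"
proof -
  obtain c where c: "c \<in> A" "q \<in> fst c"
    using q topspace_eq by auto
  define S where "S = snd c ` fst c"
  define x where "x = snd c q"
  \<comment> \<open>Coefficient vectors are taken in \<open>real ^ 'k\<close> because
    \<open>bracket_in_range\<close> asks for a Euclidean coefficient space.\<close>
  define L :: "'e \<Rightarrow> real ^ 'k \<Rightarrow> 'e" where "L y a = (\<Sum>i\<in>UNIV. a $ i *\<^sub>R local_rep c (f i) y)" for y a
  have S: "open S" "x \<in> S"
    using chart_open(2)[OF c(1)] c by (auto simp: S_def x_def)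
  have lin: "linear (L y)" for y
    unfolding L_def by (intro linearI) (simp_all add: scaleR_add_left sum.distrib scaleR_sum_right)
  have tangent: "f i q \<in> tangent_space A q" for i
    using smooth_vfield_tangent[OF f c] .
  have L_x: "L x a = (\<Sum>i\<in>UNIV. a $ i *\<^sub>R f i q) c" for a
    using c by (simp add: L_def x_def sum_fun_apply)
  have sum_tangent: "(\<Sum>i\<in>UNIV. a i *\<^sub>R f i q) \<in> tangent_space A q" for a
    by (intro subspace_sum subspace_scale subspace_tangent_space tangent)
  have "inj (L x)"
    unfolding linear_injective_0[OF lin]
  proof (intro allI impI)
    fix a
    assume "L x a = 0"
    then have "(\<Sum>i\<in>UNIV. a $ i *\<^sub>R f i q) = 0"
      using tangent_space_eqI[OF sum_tangent subspace_0[OF subspace_tangent_space] c] by (simp add: L_x)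
    then show "a = 0"
      using indep by (simp add: vec_eq_iff)
  qed
  have DL: "((\<lambda>y. L y a) has_derivative
      (\<lambda>v. \<Sum>i\<in>UNIV. a $ i *\<^sub>R frechet_derivative (local_rep c (f i)) (at x) v)) (at x)" for a
    unfolding L_def x_def
    by (intro has_derivative_sum has_derivative_scaleR_right local_rep_has_derivative f c)
  then have diff: "(\<lambda>y. L y a) differentiable (at x)" for a
    using differentiableI by blast
  have sec: "local_rep c k y \<in> range (L y)"
    if k: "k \<in> sections A (span_distr (range f))" and y: "y \<in> S" for k y
  proof -
    obtain r where r: "y = snd c r" "r \<in> fst c"
      using y by (auto simp: S_def)
    have "k r \<in> span (range (\<lambda>i. f i r))"
      using k r(2) c(1) unfolding sections_def span_distr_def by (auto simp: image_image)
    also have "\<dots> \<subseteq> range (\<lambda>u. \<Sum>i\<in>UNIV. u i *\<^sub>R f i r)"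
      by (rule span_range_subset)
    finally obtain u where "k r = (\<Sum>i\<in>UNIV. u i *\<^sub>R f i r)"
      by blast
    then have "local_rep c k y = L y (\<chi> i. u i)"
      using r c(1) by (simp add: L_def sum_fun_apply)
    then show ?thesis
      by blast
  qed
  have Dg: "(local_rep c g has_derivative frechet_derivative (local_rep c g) (at x)) (at x)"
    and Dh: "(local_rep c h has_derivative frechet_derivative (local_rep c h) (at x)) (at x)"
    using g h unfolding sections_def x_def by (blast intro: local_rep_has_derivative c)+
  obtain \<alpha> \<beta> \<gamma> where eq:
    "frechet_derivative (local_rep c h) (at x) (local_rep c g x)
      - frechet_derivative (local_rep c g) (at x) (local_rep c h x)
      - (frechet_derivative (\<lambda>y. L y \<beta>) (at x) (L x \<alpha>)
         - frechet_derivative (\<lambda>y. L y \<alpha>) (at x) (L x \<beta>)) = L x \<gamma>"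
    using bracket_in_range[OF S lin \<open>inj (L x)\<close> diff sec[OF g] Dg sec[OF h] Dh] by blast
  define w where "w = (\<Sum>i\<in>UNIV. \<Sum>j\<in>UNIV. (\<alpha> $ i * \<beta> $ j) *\<^sub>R lie_bracket A (f i) (f j) q)
    + (\<Sum>i\<in>UNIV. \<gamma> $ i *\<^sub>R f i q)"
  have D_expand: "frechet_derivative (\<lambda>y. L y a) (at x) (L x b) =
      (\<Sum>i\<in>UNIV. \<Sum>j\<in>UNIV. (a $ i * b $ j) *\<^sub>R frechet_derivative (local_rep c (f i)) (at x) (f j q c))" for a b
  proof -
    have "linear (frechet_derivative (local_rep c (f i)) (at x))" for i
      unfolding x_def using local_rep_has_derivative[OF f c] by (rule has_derivative_linear)
    then show ?thesis
      using c by (simp add: frechet_derivative_at[OF DL, symmetric] L_x sum_fun_apply linear_sum linear_scale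
          scaleR_sum_right)
  qed
  have "lie_bracket A g h q = w"
  proof (rule tangent_space_eqI[OF _ _ c])
    show "lie_bracket A g h q \<in> tangent_space A q"
      using g h unfolding sections_def by (blast intro: lie_bracket_in_tangent_space)
    show "w \<in> tangent_space A q"
      unfolding w_def by (intro subspace_add subspace_sum subspace_scale subspace_tangent_space
          lie_bracket_in_tangent_space f tangent)
    \<comment> \<open>Exchanging the summation indices gives both halves of the commutator the same
      coefficients, so that they combine into Lie brackets.\<close>
    have swap: "(\<Sum>i\<in>UNIV. \<Sum>j\<in>UNIV. (\<beta> $ i * \<alpha> $ j) *\<^sub>R frechet_derivative (local_rep c (f i)) (at x) (f j q c)) =
      (\<Sum>i\<in>UNIV. \<Sum>j\<in>UNIV. (\<alpha> $ i * \<beta> $ j) *\<^sub>R frechet_derivative (local_rep c (f j)) (at x) (f i q c))"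
      by (subst sum.swap) (simp add: mult.commute)
    have "w c = (\<Sum>i\<in>UNIV. \<Sum>j\<in>UNIV. (\<alpha> $ i * \<beta> $ j) *\<^sub>R lie_bracket A (f i) (f j) q c) + L x \<gamma>"
      by (simp add: w_def sum_fun_apply L_x)
    also have "\<dots> = (\<Sum>i\<in>UNIV. \<Sum>j\<in>UNIV. (\<alpha> $ i * \<beta> $ j) *\<^sub>R frechet_derivative (local_rep c (f j)) (at x) (f i q c))
      - (\<Sum>i\<in>UNIV. \<Sum>j\<in>UNIV. (\<alpha> $ i * \<beta> $ j) *\<^sub>R frechet_derivative (local_rep c (f i)) (at x) (f j q c)) + L x \<gamma>"
      by (simp add: lie_bracket_chart[OF c] scaleR_diff_right sum_subtractf x_def)
    also have "\<dots> = lie_bracket A g h q c"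
      using eq c by (simp add: D_expand swap lie_bracket_chart[OF c]) (simp add: x_def algebra_simps)
    finally show "lie_bracket A g h q c = w c" ..
  qed
  moreover have "w \<in> span (range (\<lambda>i. f i q) \<union> range (\<lambda>(i, j). lie_bracket A (f i) (f j) q))"
    unfolding w_def by (intro span_add span_sum span_scale span_base) auto
  ultimately show ?thesis
    by simp
qed

text \<open>This reduces the brackets of all sections to finitely many generators, on which
  dimensions can be counted. One inclusion is \<open>lie_bracket_in_frame_span\<close>; the other
  holds because the frame fields are themselves sections.\<close>

lemma square_distr_frame:
  fixes f :: "'k::finite \<Rightarrow> ('m, 'e) vfield"
  assumes f: "\<And>i. smooth_vfield A (f i)" and q: "q \<in> topspace M"
    and indep: "\<And>a. (\<Sum>i\<in>UNIV. a i *\<^sub>R f i q) = 0 \<Longrightarrow> \<forall>i. a i = 0"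
  shows "square_distr A (span_distr (range f)) q =
    span (range (\<lambda>i. f i q) \<union> range (\<lambda>(i, j). lie_bracket A (f i) (f j) q))"
proof -
  define Y where "Y = {lie_bracket A g h q | g h.
    g \<in> sections A (span_distr (range f)) \<and> h \<in> sections A (span_distr (range f))}"
  have sec: "f i \<in> sections A (span_distr (range f))" for i
    using f by (auto simp: sections_def span_distr_def intro!: span_base)
  have "square_distr A (span_distr (range f)) q = span (range (\<lambda>i. f i q) \<union> Y)"
    unfolding square_distr_def distr_sum_def bracket_distr_def Y_def[symmetric] span_distr_def span_Un
    by (auto simp: image_image)
  also have "\<dots> = span (range (\<lambda>i. f i q) \<union> range (\<lambda>(i, j). lie_bracket A (f i) (f j) q))"
    unfolding span_eq
  proof (intro conjI Un_least)
    show "Y \<subseteq> span (range (\<lambda>i. f i q) \<union> range (\<lambda>(i, j). lie_bracket A (f i) (f j) q))"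
      unfolding Y_def using lie_bracket_in_frame_span[of f, OF f q indep] by blast
    show "range (\<lambda>(i, j). lie_bracket A (f i) (f j) q) \<subseteq> span (range (\<lambda>i. f i q) \<union> Y)"
      using sec by (auto simp: Y_def intro!: span_base)
  qed (auto intro: span_base)
  finally show ?thesis .
qed

section \<open>Hamiltonians linear on the fibres\<close>

lemma cotangent_linear:
  assumes "p \<in> cotangent_space A q"
  shows "v \<in> tangent_space A q \<Longrightarrow> w \<in> tangent_space A q \<Longrightarrow> p (v + w) = p v + p w"
    and "v \<in> tangent_space A q \<Longrightarrow> p (r *\<^sub>R v) = r * p v"
    and "p 0 = 0"
proof -
  show *: "p (r *\<^sub>R v) = r * p v" if "v \<in> tangent_space A q" for r v
    using assms that unfolding cotangent_space_def by blast
  show "p 0 = 0"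
    using *[of 0 0] subspace_0[OF subspace_tangent_space] by simp
qed (use assms in \<open>unfold cotangent_space_def, blast\<close>)

text \<open>A covector is linear only on the tangent space, so the induction also has to keep the
  partial sums inside that space.\<close>

lemma cotangent_sum:
  assumes p: "p \<in> cotangent_space A q" and u: "\<And>i. i \<in> I \<Longrightarrow> u i \<in> tangent_space A q"
  shows "p (\<Sum>i\<in>I. r i *\<^sub>R u i) = (\<Sum>i\<in>I. r i * p (u i))"
  using u
proof (induction I rule: infinite_finite_induct)
  case (insert i I)
  then have u: "u i \<in> tangent_space A q" and us: "(\<Sum>i\<in>I. r i *\<^sub>R u i) \<in> tangent_space A q"
    by (auto intro!: subspace_sum subspace_scale subspace_tangent_space)
  have "p (\<Sum>i\<in>I. r i *\<^sub>R u i) = (\<Sum>i\<in>I. r i * p (u i))"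
    using insert.IH insert.prems by blast
  then show ?case
    unfolding sum.insert[OF insert.hyps]
    by (simp only: cotangent_linear[OF p] u us subspace_scale[OF subspace_tangent_space u])
qed (simp_all add: cotangent_linear[OF p])

lemma cotangent_span_zero:
  assumes p: "p \<in> cotangent_space A q"
    and X: "X \<subseteq> tangent_space A q" "\<And>v. v \<in> X \<Longrightarrow> p v = 0" and v: "v \<in> span X"
  shows "p v = 0"
proof -
  have "v \<in> {v \<in> tangent_space A q. p v = 0}"
    using v
  proof (rule span_subspace_induct)
    show "subspace {v \<in> tangent_space A q. p v = 0}"
      using subspace_tangent_space[of q] cotangent_linear[OF p]
      by (auto simp: subspace_def)
    show "x \<in> {v \<in> tangent_space A q. p v = 0}" if "x \<in> X" for x
      using X that by auto
  qed
  then show ?thesis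
    by blast
qed

lemma cotangent_coords:
  assumes p: "p \<in> cotangent_space A q" and c: "c \<in> A" "q \<in> fst c" and v: "v \<in> tangent_space A q"
  shows "p v = snd (ct_coords A c (q, p)) \<bullet> v c"
proof -
  have "p v = p (\<Sum>b\<in>Basis. (v c \<bullet> b) *\<^sub>R coord_vector A c q b)"
    using tangent_eq_sum_coord_vector[OF v c] by simp
  also have "\<dots> = (\<Sum>b\<in>Basis. (v c \<bullet> b) * p (coord_vector A c q b))"
    by (rule cotangent_sum[OF p coord_vector_in_tangent_space[OF c]])
  finally show ?thesis
    by (simp add: ct_coords_def inner_sum_left inner_commute[of "v c"] mult.commute)
qed

section \<open>Hamiltonian fields and Poisson brackets of lifts\<close>

lemma ct_derivative_lift_ham:
  assumes f: "smooth_vfield A f" and c: "c \<in> A" "q \<in> fst c"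
  shows "ct_derivative A c (lift_ham f) (q, p) (y, \<eta>) =
    snd (ct_coords A c (q, p)) \<bullet> frechet_derivative (local_rep c f) (at (snd c q)) y + \<eta> \<bullet> f q c"
proof -
  define \<xi> where "\<xi> = snd (ct_coords A c (q, p))"
  define DF where "DF = frechet_derivative (local_rep c f) (at (snd c q))"
  have coords: "ct_coords A c (q, p) = (snd c q, \<xi>)"
    by (simp add: \<xi>_def ct_coords_def)
  have DF: "(local_rep c f has_derivative DF) (at (fst (snd c q, \<xi>)))"
    using local_rep_has_derivative[OF f c] by (simp add: DF_def)
  \<comment> \<open>In canonical coordinates the lift is the inner product of \<open>\<xi>\<close>
    with the local representative at \<open>x\<close>, and the product rule applies. The two
    functions agree over the chart image, where \<open>chart_inv\<close> is a genuine
    inverse.\<close>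
  have "((\<lambda>z. snd z \<bullet> local_rep c f (fst z)) has_derivative
      (\<lambda>w. snd (snd c q, \<xi>) \<bullet> DF (fst w) + snd w \<bullet> local_rep c f (fst (snd c q, \<xi>)))) (at (snd c q, \<xi>))"
    by (intro has_derivative_inner has_derivative_snd has_derivative_ident
        has_derivative_compose[OF has_derivative_fst[OF has_derivative_ident] DF])
  then have "(lift_ham f \<circ> ct_coords_inv A c has_derivative
      (\<lambda>w. snd (snd c q, \<xi>) \<bullet> DF (fst w) + snd w \<bullet> local_rep c f (fst (snd c q, \<xi>)))) (at (snd c q, \<xi>))"
  proof (rule has_derivative_transform_within_open)
    show "open ((snd c ` fst c) \<times> (UNIV :: 'e set))"
      by (intro open_Times chart_open c open_UNIV)
    show "(snd c q, \<xi>) \<in> (snd c ` fst c) \<times> UNIV"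
      using c by simp
    fix z :: "'e \<times> 'e"
    assume "z \<in> (snd c ` fst c) \<times> UNIV"
    then obtain r \<zeta> where "z = (snd c r, \<zeta>)" "r \<in> fst c"
      by auto
    then show "snd z \<bullet> local_rep c f (fst z) = (lift_ham f \<circ> ct_coords_inv A c) z"
      using c(1) smooth_vfield_tangent[OF f c(1)] by (simp add: lift_ham_def ct_coords_inv_def)
  qed
  note D = frechet_derivative_at[OF this, symmetric]
  show ?thesis
    using c by (simp add: ct_derivative_def coords DF_def[symmetric] D)
qed

lemma ham_field_lift_ham:
  assumes "smooth_vfield A f" and c: "c \<in> A" "q \<in> fst c"
  shows "ham_field A (lift_ham f) (q, p) c = (f q c,
    - (\<Sum>b\<in>Basis. (snd (ct_coords A c (q, p)) \<bullet>
         frechet_derivative (local_rep c f) (at (snd c q)) b) *\<^sub>R b))"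
proof -
  have "linear (frechet_derivative (local_rep c f) (at (snd c q)))"
    using local_rep_has_derivative[OF assms] by (rule has_derivative_linear)
  moreover have "(\<Sum>b\<in>Basis. (b \<bullet> f q c) *\<^sub>R b) = f q c"
    by (simp add: inner_commute[of _ "f q c"] euclidean_representation)
  ultimately show ?thesis
    using c by (simp add: ham_field_def ct_derivative_lift_ham[OF assms] linear_0)
qed

lemma proj_push_ham_field_lift_ham:
  assumes f: "smooth_vfield A f" and q: "q \<in> topspace M"
  shows "proj_push (ham_field A (lift_ham f) (q, p)) = f q"
proof
  fix c
  have "f q \<in> tangent_space A q"
    using f q unfolding smooth_vfield_def topspace_eq by blast
  \<comment> \<open>At indices that are not charts around \<open>q\<close> both sides have the
    default value 0.\<close>
  then show "proj_push (ham_field A (lift_ham f) (q, p)) c = f q c"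
    by (cases "c \<in> A \<and> q \<in> fst c")
      (auto simp: proj_push_def ham_field_lift_ham[OF f], auto simp: ham_field_def tangent_space_zero)
qed

lemma poisson_lift_ham:
  assumes f: "smooth_vfield A f" and g: "smooth_vfield A g"
    and q: "q \<in> topspace M" and p: "p \<in> cotangent_space A q"
  shows "poisson A (lift_ham f) (lift_ham g) (q, p) = p (lie_bracket A f g q)"
proof -
  \<comment> \<open>This is the chart chosen in the definition of \<open>poisson\<close>. The base
    component of the Hamiltonian field contributes the derivative of \<open>g\<close> along
    \<open>f\<close>, and the fibre component contributes minus the derivative of \<open>f\<close>
    along \<open>g\<close>.\<close>
  define c where "c = (SOME c. c \<in> A \<and> q \<in> fst c)"
  have "\<exists>c. c \<in> A \<and> q \<in> fst c"
    using q unfolding topspace_eq by blast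
  from someI_ex[OF this] have c: "c \<in> A" "q \<in> fst c"
    unfolding c_def by blast+
  define \<xi> where "\<xi> = snd (ct_coords A c (q, p))"
  define DF where "DF = frechet_derivative (local_rep c f) (at (snd c q))"
  interpret DF: linear DF
    unfolding DF_def using local_rep_has_derivative[OF f c] by (rule has_derivative_linear)
  have "DF (g q c) = (\<Sum>b\<in>Basis. (g q c \<bullet> b) *\<^sub>R DF b)"
    by (simp only: DF.sum[symmetric] DF.scale[symmetric] euclidean_representation)
  then have "\<xi> \<bullet> DF (g q c) = (\<Sum>b\<in>Basis. (\<xi> \<bullet> DF b) *\<^sub>R b) \<bullet> g q c"
    by (simp add: inner_sum_left inner_sum_right inner_commute mult.commute)
  then have "poisson A (lift_ham f) (lift_ham g) (q, p) = \<xi> \<bullet> lie_bracket A f g q c"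
    unfolding poisson_def fst_conv c_def[symmetric] Let_def
    by (simp add: ham_field_lift_ham[OF f c] ct_derivative_lift_ham[OF g c] lie_bracket_chart[OF c]
        \<xi>_def[symmetric] DF_def[symmetric] inner_diff_right)
  then show ?thesis
    using cotangent_coords[OF p c lie_bracket_in_tangent_space[OF f g]] by (simp add: \<xi>_def)
qed

lemma proj_push_abn_field:
  assumes f: "smooth_vfield A f0" "smooth_vfield A f1" "smooth_vfield A f2"
    and q: "q \<in> topspace M" and p: "p \<in> cotangent_space A q"
  shows "proj_push (abn_field A f0 f1 f2 (q, p)) = f0 q
    + (p (lie_bracket A f0 f2 q) / p (lie_bracket A f2 f1 q)) *\<^sub>R f1 q
    + (p (lie_bracket A f1 f0 q) / p (lie_bracket A f2 f1 q)) *\<^sub>R f2 q"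
proof -
  have "proj_push (U + r *\<^sub>R V + s *\<^sub>R W) = proj_push U + r *\<^sub>R proj_push V + s *\<^sub>R proj_push W"
    for U V W :: "('m, 'e) ct_tvec" and r s
    by (simp add: proj_push_def fun_eq_iff)
  then show ?thesis
    using f by (simp add: abn_field_def Let_def proj_push_ham_field_lift_ham[OF _ q] poisson_lift_ham[OF _ _ q p])
qed

end

section \<open>The set of abnormal velocities\<close>

lemma independent_of_dim_span_ge:
  fixes B :: "'v::real_vector set"
  assumes "finite B" "card B \<le> dim (span B)"
  shows "independent B"
proof -
  obtain C where C: "C \<subseteq> B" "independent C" "B \<subseteq> span C" "card C = dim B"
    by (rule basis_exists)
  then have "C = B"
    using assms by (intro card_seteq) auto
  then show ?thesis
    using C(2) by simp
qed

text \<open>Modulo \<open>span W\<close> the vectors \<open>u\<close> and \<open>v\<close> span a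
  line. It is generated by \<open>u\<close> unless \<open>u\<close> lies in \<open>span W\<close>,
  and then by \<open>v\<close>; the generator has coefficient 1, so the pair of coefficients is
  nonzero.\<close>

lemma dim_span_insert2_SucE:
  fixes W :: "'v::real_vector set"
  assumes W: "finite W" "independent W" and dim: "dim (span (W \<union> {u, v})) = Suc (card W)"
  obtains b \<mu> \<nu> where "b \<in> {u, v}" "b \<notin> span W" "u - \<mu> *\<^sub>R b \<in> span W" "v - \<nu> *\<^sub>R b \<in> span W" "(\<mu>, \<nu>) \<noteq> 0"
proof (cases "u \<in> span W")
  case True
  have "v \<notin> span W"
  proof
    assume "v \<in> span W"
    then have "span (W \<union> {u, v}) = span W"
      using True unfolding span_eq by (auto intro: span_base)
    then show False
      using dim dim_span_eq_card_independent[OF W(2)] by simp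
  qed
  then show thesis
    using True by (intro that[of v 0 1]) (auto simp: zero_prod_def span_0)
next
  case False
  then have uW: "independent (insert u W)" and "u \<notin> W"
    using W(2) by (auto simp: independent_insert span_base)
  have "v \<in> span (insert u W)"
  proof (rule ccontr)
    assume v: "v \<notin> span (insert u W)"
    then have "independent (insert v (insert u W))" "v \<notin> insert u W"
      using uW by (auto simp: independent_insert span_base)
    moreover have "insert v (insert u W) = W \<union> {u, v}"
      by auto
    ultimately show False
      using dim dim_span_eq_card_independent[of "W \<union> {u, v}"] \<open>u \<notin> W\<close> W(1)
      by (metis card_insert_disjoint finite_insert n_not_Suc_n)
  qed
  then obtain \<nu> where "v - \<nu> *\<^sub>R u \<in> span W"
    using span_breakdown_eq by blast
  then show thesis
    using False by (intro that[of u 1 \<nu>]) (auto simp: zero_prod_def span_0)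
qed

lemma affine_line_range:
  fixes v d :: "'v::real_vector"
  assumes "d \<noteq> 0"
  shows "affine_line (range (\<lambda>s. v + s *\<^sub>R d))"
  unfolding affine_line_def
proof (intro exI conjI)
  show "v \<noteq> v + d"
    using assms by simp
  have "a *\<^sub>R v + b *\<^sub>R (v + d) = v + b *\<^sub>R d" if "a + b = 1" for a b
    using that by (simp add: scaleR_add_right flip: add.assoc scaleR_add_left)
  then show "range (\<lambda>s. v + s *\<^sub>R d) = affine hull {v, v + d}"
    unfolding affine_hull_2 by (auto simp: image_iff) (metis add.commute diff_add_cancel)
qed

section \<open>Generators for frames of two and three fields\<close>

lemma lie_bracket_swap: "lie_bracket A g f q = - lie_bracket A f g q"
  by (auto simp: lie_bracket_def fun_eq_iff)

lemma lie_bracket_self: "lie_bracket A f f q = 0"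
  by (auto simp: lie_bracket_def fun_eq_iff)

lemma square_distr_frame_2:
  assumes M: "smooth_manifold M A" and f: "smooth_vfield A f1" "smooth_vfield A f2"
    and q: "q \<in> topspace M"
    and indep: "\<And>a b. a *\<^sub>R f1 q + b *\<^sub>R f2 q = 0 \<Longrightarrow> a = 0 \<and> b = 0"
  shows "square_distr A (span_distr {f1, f2}) q = span {lie_bracket A f1 f2 q, f1 q, f2 q}"
proof -
  \<comment> \<open>The numeral type \<open>2\<close> serves as a finite index type. By antisymmetry
    its four brackets are zero or plus or minus the bracket of \<open>f1\<close> and
    \<open>f2\<close>.\<close>
  define f :: "2 \<Rightarrow> _" where "f i = (if i = 1 then f1 else f2)" for i
  have f_simps: "f 1 = f1" "f 2 = f2"
    by (simp_all add: f_def)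
  have r: "range f = {f1, f2}" "range (\<lambda>i. f i q) = {f1 q, f2 q}"
    by (simp_all add: UNIV_2 f_simps)
  have brackets: "range (\<lambda>(i, j). lie_bracket A (f i) (f j) q) =
      {0, lie_bracket A f1 f2 q, - lie_bracket A f1 f2 q}"
    unfolding UNIV_Times_UNIV[symmetric] UNIV_2
    by (auto simp: f_simps lie_bracket_self lie_bracket_swap[of A f2 f1])
  have "square_distr A (span_distr (range f)) q =
      span (range (\<lambda>i. f i q) \<union> range (\<lambda>(i, j). lie_bracket A (f i) (f j) q))"
  proof (rule square_distr_frame[OF M _ q])
    show "smooth_vfield A (f i)" for i
      using f by (simp add: f_def)
    show "\<forall>i. a i = 0" if "(\<Sum>i\<in>UNIV. a i *\<^sub>R f i q) = 0" for a
      using indep[of "a 1" "a 2"] that by (simp add: sum_2 f_simps forall_2)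
  qed
  also have "\<dots> = span {lie_bracket A f1 f2 q, f1 q, f2 q}"
    unfolding r brackets span_eq by (auto intro: span_base span_neg span_0)
  finally show ?thesis
    by (simp add: r)
qed

text \<open>The generators are grouped so that the first four span the sum of the square of span(f1,
  f2) and span(f0, f1, f2); only the last two can raise the dimension.\<close>

lemma square_distr_frame_3:
  assumes M: "smooth_manifold M A"
    and f: "smooth_vfield A f0" "smooth_vfield A f1" "smooth_vfield A f2"
    and q: "q \<in> topspace M"
    and indep: "\<And>a b c. a *\<^sub>R f0 q + b *\<^sub>R f1 q + c *\<^sub>R f2 q = 0 \<Longrightarrow> a = 0 \<and> b = 0 \<and> c = 0"
  shows "square_distr A (span_distr {f0, f1, f2}) q = span ({lie_bracket A f1 f2 q, f0 q, f1 q, f2 q}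
    \<union> {lie_bracket A f0 f1 q, lie_bracket A f0 f2 q})"
proof -
  define f :: "3 \<Rightarrow> _" where "f i = (if i = 1 then f0 else if i = 2 then f1 else f2)" for i
  have f_simps: "f 1 = f0" "f 2 = f1" "f 3 = f2"
    by (simp_all add: f_def)
  have r: "range f = {f0, f1, f2}" "range (\<lambda>i. f i q) = {f0 q, f1 q, f2 q}"
    by (simp_all add: UNIV_3 f_simps)
  have brackets: "range (\<lambda>(i, j). lie_bracket A (f i) (f j) q) =
      {0, lie_bracket A f0 f1 q, - lie_bracket A f0 f1 q, lie_bracket A f0 f2 q,
        - lie_bracket A f0 f2 q, lie_bracket A f1 f2 q, - lie_bracket A f1 f2 q}"
    unfolding UNIV_Times_UNIV[symmetric] UNIV_3
    by (auto simp: f_simps lie_bracket_self lie_bracket_swap[of A f1 f0] lie_bracket_swap[of A f2 f0]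
        lie_bracket_swap[of A f2 f1])
  have "square_distr A (span_distr (range f)) q =
      span (range (\<lambda>i. f i q) \<union> range (\<lambda>(i, j). lie_bracket A (f i) (f j) q))"
  proof (rule square_distr_frame[OF M _ q])
    show "smooth_vfield A (f i)" for i
      using f by (simp add: f_def)
    show "\<forall>i. a i = 0" if "(\<Sum>i\<in>UNIV. a i *\<^sub>R f i q) = 0" for a
      using indep[of "a 1" "a 2" "a 3"] that by (simp add: sum_3 f_simps forall_3)
  qed
  also have "\<dots> = span ({lie_bracket A f1 f2 q, f0 q, f1 q, f2 q}
    \<union> {lie_bracket A f0 f1 q, lie_bracket A f0 f2 q})"
    unfolding r brackets span_eq by (auto intro: span_base span_neg span_0)
  finally show ?thesis
    by (simp add: r)
qed

section \<open>The abnormal velocities as the range of an affine map\<close>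

theorem proposition5:
  fixes M :: "'m topology"
    and A :: "('m, real^5) chart set"
    and f0 f1 f2 :: "('m, real^5) vfield"
    and q :: 'm
  assumes "smooth_manifold M A"
    and "smooth_vfield A f0" and "smooth_vfield A f1" and "smooth_vfield A f2"
    and "\<And>x a b c. x \<in> topspace M \<Longrightarrow> a *\<^sub>R f0 x + b *\<^sub>R f1 x + c *\<^sub>R f2 x = 0
           \<Longrightarrow> a = 0 \<and> b = 0 \<and> c = 0"
    and "q \<in> topspace M"
    and "dim (distr_sum (square_distr A (span_distr {f1, f2})) (span_distr {f0, f1, f2}) q) = 4"
    and "dim (square_distr A (span_distr {f0, f1, f2}) q) = 5"
  shows "affine_line (Abn A f0 f1 f2 q)"
proof -
  note M = assms(1) and f = assms(2-4) and q = assms(6)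
  note indep = assms(5)[OF q]
  note cot = cotangent_linear[OF M] and cot_span = cotangent_span_zero[OF M]
  define T where "T = tangent_space A q"
  define E where "E = {f0 q, f1 q, f2 q}"
  define b01 where "b01 = lie_bracket A f0 f1 q"
  define b02 where "b02 = lie_bracket A f0 f2 q"
  define b12 where "b12 = lie_bracket A f1 f2 q"
  define W where "W = insert b12 E"
  have fT: "f0 q \<in> T" "f1 q \<in> T" "f2 q \<in> T"
    using f q unfolding smooth_vfield_def topspace_eq[OF M] T_def by blast+
  have bT: "b01 \<in> T" "b02 \<in> T" "b12 \<in> T"
    unfolding b01_def b02_def b12_def T_def using f by (blast intro: lie_bracket_in_tangent_space[OF M])+
  have ET: "E \<subseteq> T" and WT: "W \<subseteq> T"
    using fT bT by (auto simp: E_def W_def)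
  have T: "subspace T"
    unfolding T_def by (rule subspace_tangent_space[OF M])
  have D2: "square_distr A (span_distr {f1, f2}) q = span {b12, f1 q, f2 q}"
    unfolding b12_def using indep[of 0] by (intro square_distr_frame_2[OF M f(2,3) q]) simp
  have D3: "square_distr A (span_distr {f0, f1, f2}) q = span (W \<union> {b01, b02})"
    unfolding W_def E_def b12_def b01_def b02_def by (rule square_distr_frame_3[OF M f q indep])
  have "distr_sum (square_distr A (span_distr {f1, f2})) (span_distr {f0, f1, f2}) q =
      span ({b12, f1 q, f2 q} \<union> E)"
    unfolding distr_sum_def D2 span_Un by (auto simp: span_distr_def E_def)
  also have "{b12, f1 q, f2 q} \<union> E = W"
    by (auto simp: W_def E_def)
  finally have dimW: "dim (span W) = 4"
    using assms(7) by simp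
  \<comment> \<open>Four listed generators with a span of dimension 4 must be distinct and
    independent.\<close>
  have W_fin: "finite W" and W_le: "card W \<le> 4"
    by (auto simp: W_def E_def card_insert_if)
  then have W_ind: "independent W"
    using dimW by (intro independent_of_dim_span_ge) simp_all
  then have W_card: "card W = 4"
    using dimW dim_span_eq_card_independent by metis
  \<comment> \<open>If \<open>b12\<close> were in \<open>E\<close>, then \<open>W\<close> would have
    at most three elements. The membership is excluded so that a functional can vanish on
    \<open>E\<close> and be 1 at \<open>b12\<close>.\<close>
  have "card E \<le> 3"
    by (simp add: E_def card_insert_if)
  then have b12E: "b12 \<notin> E"
    using W_card by (auto simp: W_def insert_absorb)
  have "dim (span (W \<union> {b01, b02})) = Suc (card W)"
    using assms(8) by (simp add: D3 W_card)
  then obtain b \<mu> \<nu> where b: "b \<in> {b01, b02}" "b \<notin> span W"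
    and \<mu>: "b01 - \<mu> *\<^sub>R b \<in> span W" and \<nu>: "b02 - \<nu> *\<^sub>R b \<in> span W" and \<mu>\<nu>: "(\<mu>, \<nu>) \<noteq> 0"
    by (rule dim_span_insert2_SucE[OF W_fin W_ind])
  \<comment> \<open>Splitting off the components along \<open>b12\<close> leaves remainders in
    \<open>span E\<close>, where the relevant covectors vanish.\<close>
  obtain \<beta>1 \<beta>2 where \<beta>: "b01 - \<mu> *\<^sub>R b - \<beta>1 *\<^sub>R b12 \<in> span E" "b02 - \<nu> *\<^sub>R b - \<beta>2 *\<^sub>R b12 \<in> span E"
    using \<mu> \<nu> unfolding W_def span_breakdown_eq by blast
  have bT': "b \<in> T"
    using b bT by blast
  \<comment> \<open>Here \<open>s\<close> stands for \<open>p b / p b12\<close>. Since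
    \<open>p\<close> changes sign when a bracket is reversed, the coefficients of \<open>f1\<close>
    and \<open>f2\<close> are \<open>- p b02 / p b12\<close> and
    \<open>p b01 / p b12\<close>.\<close>
  define v where "v s = f0 q + (- \<beta>2 - \<nu> * s) *\<^sub>R f1 q + (\<beta>1 + \<mu> * s) *\<^sub>R f2 q" for s
  have value_at: "p u = r * p b + s * p b12"
    if p: "p \<in> cotangent_space A q" "\<And>w. w \<in> E \<Longrightarrow> p w = 0" and u: "u - r *\<^sub>R b - s *\<^sub>R b12 \<in> span E"
    for p u r s
  proof -
    have z: "p (u - r *\<^sub>R b - s *\<^sub>R b12) = 0"
      using cot_span[OF p(1) _ p(2) u] ET by (simp add: T_def)
    have zT: "u - r *\<^sub>R b - s *\<^sub>R b12 \<in> T"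
      using u ET T span_minimal by blast
    have "u = (u - r *\<^sub>R b - s *\<^sub>R b12) + (r *\<^sub>R b + s *\<^sub>R b12)"
      by simp
    then have "p u = p (u - r *\<^sub>R b - s *\<^sub>R b12) + p (r *\<^sub>R b + s *\<^sub>R b12)"
      using cot(1)[OF p(1)] zT T bT bT' unfolding T_def
      by (metis subspace_add subspace_scale)
    also have "p (r *\<^sub>R b + s *\<^sub>R b12) = r * p b + s * p b12"
      using cot(1,2)[OF p(1)] T bT(3) bT' unfolding T_def by (metis subspace_scale)
    finally show ?thesis
      by (simp only: z add_0_left)
  qed
  have velocity: "proj_push (abn_field A f0 f1 f2 (q, p)) = v (p b / p b12)"
    if p: "p \<in> cotangent_space A q" "\<And>w. w \<in> E \<Longrightarrow> p w = 0" and nz: "p b12 \<noteq> 0" for p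
  proof -
    have neg: "p (- w) = - p w" if "w \<in> T" for w
      using cot(2)[OF p(1), of w "- 1"] that by (simp add: T_def)
    have b01_eq: "p b01 = \<mu> * p b + \<beta>1 * p b12" and b02_eq: "p b02 = \<nu> * p b + \<beta>2 * p b12"
      using value_at[OF p] \<beta> by blast+
    have "p b02 / - p b12 = - \<beta>2 - \<nu> * (p b / p b12)"
      using nz b02_eq by (simp add: field_simps)
    moreover have "- p b01 / - p b12 = \<beta>1 + \<mu> * (p b / p b12)"
      using nz b01_eq by (simp add: field_simps)
    ultimately show ?thesis
      unfolding proj_push_abn_field[OF M f q p(1)] lie_bracket_swap[of A f2 f1] lie_bracket_swap[of A f1 f0]
        b01_def[symmetric] b02_def[symmetric] b12_def[symmetric] neg[OF bT(1)] neg[OF bT(3)] v_def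
      by (simp only:)
  qed
  \<comment> \<open>A covector annihilates span(f0, f1, f2) exactly when it vanishes on
    \<open>E\<close>. Among these, lying outside the annihilator of the square of span(f1, f2)
    amounts to being nonzero at \<open>b12\<close>, its only further generator.\<close>
  have Abn_eq: "Abn A f0 f1 f2 q = {proj_push (abn_field A f0 f1 f2 (q, p)) | p.
      p \<in> cotangent_space A q \<and> (\<forall>w\<in>E. p w = 0) \<and> p b12 \<noteq> 0}"
  proof -
    have "(q, p) \<in> cotangent_fibre A q \<inter> annihilator A (span_distr {f0, f1, f2})
        - annihilator A (square_distr A (span_distr {f1, f2})) \<longleftrightarrow>
      p \<in> cotangent_space A q \<and> (\<forall>w\<in>E. p w = 0) \<and> p b12 \<noteq> 0" (is "?L \<longleftrightarrow> ?R") for p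
    proof -
      have qA: "q \<in> \<Union> (fst ` A)"
        using q topspace_eq[OF M] by simp
      have D3E: "span_distr {f0, f1, f2} q = span E"
        by (simp add: span_distr_def E_def)
      show ?thesis
      proof
        assume L: ?L
        then have p: "p \<in> cotangent_space A q" and pE: "\<And>w. w \<in> E \<Longrightarrow> p w = 0"
          by (auto simp: cotangent_fibre_def annihilator_def D3E intro: span_base)
        have "p b12 \<noteq> 0"
        proof
          assume "p b12 = 0"
          then have "p w = 0" if "w \<in> span {b12, f1 q, f2 q}" for w
            using cot_span[OF p _ _ that] pE fT bT by (auto simp: T_def E_def)
          then show False
            using L p qA by (auto simp: annihilator_def D2)
        qed
        then show ?R
          using p pE by blast
      next
        assume R: ?R
        then have "p w = 0" if "w \<in> span E" for w
          using cot_span[OF _ _ _ that] ET by (auto simp: T_def)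
        moreover have "b12 \<in> span {b12, f1 q, f2 q}"
          by (intro span_base) simp
        ultimately show ?L
          using R qA by (auto simp: cotangent_fibre_def annihilator_def D3E D2)
      qed
    qed
    then show ?thesis
      unfolding Abn_def cotangent_fibre_def by blast
  qed
  have "Abn A f0 f1 f2 q = range v"
  proof (intro equalityI subsetI)
    fix w
    assume "w \<in> Abn A f0 f1 f2 q"
    then show "w \<in> range v"
      unfolding Abn_eq using velocity by blast
  next
    fix w
    assume "w \<in> range v"
    then obtain s where w: "w = v s"
      by blast
    have "independent (insert b W)"
      using W_ind b(2) by (simp add: independent_insert)
    \<comment> \<open>Values on the independent set \<open>insert b W\<close> can be prescribed
      freely: \<open>s\<close> at \<open>b\<close> and 1 at \<open>b12\<close> realise the ratio
      \<open>s\<close>, and 0 on \<open>E\<close> gives the annihilation.\<close>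
    then obtain P :: "('m, real^5) tvec \<Rightarrow> real" where P: "linear P"
      "\<And>x. x \<in> insert b W \<Longrightarrow> P x = (if x = b then s else if x = b12 then 1 else 0)"
      using linear_independent_extend[of "insert b W" "\<lambda>x. if x = b then s else if x = b12 then 1 else 0"]
      by blast
    \<comment> \<open>A covector must be 0 outside the tangent space, so \<open>P\<close> is cut off
      there.\<close>
    define p where "p x = (if x \<in> T then P x else 0)" for x
    have "p \<in> cotangent_space A q"
      using T unfolding cotangent_space_def T_def[symmetric]
      by (auto simp: p_def linear_add[OF P(1)] linear_scale[OF P(1)] subspace_add subspace_scale)
    moreover have "b \<notin> W"
      using b(2) span_base by blast
    then have "p x = 0" if "x \<in> E" for x
      using that b12E P(2)[of x] by (auto simp: p_def W_def)
    moreover have "p b = s"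
      using P(2)[of b] bT' by (simp add: p_def)
    moreover have "p b12 = 1"
      using P(2)[of b12] bT(3) \<open>b \<notin> W\<close> by (auto simp: p_def W_def)
    ultimately show "w \<in> Abn A f0 f1 f2 q"
      unfolding Abn_eq using velocity[of p] w by (intro CollectI exI[of _ p]) auto
  qed
  also have "v = (\<lambda>s. v 0 + s *\<^sub>R ((- \<nu>) *\<^sub>R f1 q + \<mu> *\<^sub>R f2 q))"
    by (rule ext) (simp add: v_def scaleR_add_left scaleR_diff_left scaleR_diff_right mult.commute)
  finally have Abn_range: "Abn A f0 f1 f2 q = range (\<lambda>s. v 0 + s *\<^sub>R ((- \<nu>) *\<^sub>R f1 q + \<mu> *\<^sub>R f2 q))" .
  have "(- \<nu>) *\<^sub>R f1 q + \<mu> *\<^sub>R f2 q \<noteq> 0"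
    using indep[of 0 "- \<nu>" \<mu>] \<mu>\<nu> by (auto simp: zero_prod_def)
  then show ?thesis
    unfolding Abn_range by (rule affine_line_range)
qed

end
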